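(* Let $Z_1, Z_2, \ldots$ be independent, identically distributed random vectors in $\mathbb{R}^2$ with $\mathbb{E}[\|Z_1\|^2] < \infty$ and $\|\mathbb{E}[Z_1]\| \neq 0$. Let $S_0 := 0$ and $S_n := \sum_{i=1}^n Z_i$ for $n \geq 1$, and let $L_n$ denote the length of the perimeter of the convex hull of $\{S_0, S_1, \ldots, S_n\}$. Then, as $n \to \infty$, \[ n^{-1/2} \left| L_n - \mathbb{E}[L_n] - \sum_{i=1}^n \frac{2 (Z_i - \mathbb{E}[Z_1]) \cdot \mathbb{E}[Z_1]}{\|\mathbb{E}[Z_1]\|} \right| \to 0 \quad \text{in } L^2. \]
   Context: $\cdot$ denotes the Euclidean inner product and $\|\cdot\|$ the Euclidean norm on $\mathbb{R}^2$. *)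

theory Defs
  imports "HOL-Analysis.Analysis" "HOL-Probability.Probability"
begin

text \<open>Perimeter (boundary length) of a compact convex set K in the plane.
  If K has nonempty interior it is a convex polygon (for K the hull of finitely
  many points) and its perimeter is the sum of the lengths of its edges, i.e.
  the segments between distinct extreme points lying in the frontier.
  If K has empty interior (a point or a line segment), the usual convention
  is that the perimeter is twice the length (diameter) of K.\<close>
definition perimeter :: "(real^2) set \<Rightarrow> real" where
  "perimeter K =
     (if interior K = {} then 2 * diameter K
      else (\<Sum>e \<in> {{a, b} | a b. a extreme_point_of K \<and> b extreme_point_of K \<and> a \<noteq> b
                               \<and> closed_segment a b \<subseteq> frontier K}. diameter e))"

definition walk :: "(nat \<Rightarrow> 'w \<Rightarrow> real^2) \<Rightarrow> nat \<Rightarrow> 'w \<Rightarrow> real^2" where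
  "walk Z n \<omega> = (\<Sum>i = 1..n. Z i \<omega>)"

definition hull_perimeter :: "(nat \<Rightarrow> 'w \<Rightarrow> real^2) \<Rightarrow> nat \<Rightarrow> 'w \<Rightarrow> real" where
  "hull_perimeter Z n \<omega> = perimeter (convex hull ((\<lambda>k. walk Z k \<omega>) ` {0..n}))"

end

theory Submission
  imports Defs "HOL-Real_Asymp.Real_Asymp"
begin

text \<open>Put \<open>u = \<mu> / norm \<mu>\<close> and let \<open>e \<theta>\<close> be \<open>u\<close> rotated by \<open>\<theta>\<close>. By Cauchy's formula \<open>L n\<close> is
  the integral over \<open>\<theta> \<in> {-pi/2..pi/2}\<close> of the width of the hull in direction \<open>e \<theta>\<close>, while
  \<open>2 * (S n \<bullet> u)\<close> is the integral of \<open>S n \<bullet> e \<theta>\<close>. Hence \<open>L n - 2 * (S n \<bullet> u)\<close> is the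
  integral of the nonnegative quantity \<open>(max (S k \<bullet> e \<theta>) - S n \<bullet> e \<theta>) + max (- (S k \<bullet> e \<theta>))\<close>.
  For \<open>\<bar>\<theta>\<bar> < pi/2\<close> both summands are \<open>n\<close>-th values of a Lindley recursion
  \<open>W (k + 1) = max 0 (W k + X (k + 1))\<close> whose increments \<open>- (Z i \<bullet> e \<theta>)\<close>, taken in order for the
  first summand and in reversed order for the second, have negative mean. With increments of finite
  second moment this gives \<open>E (W n)\<^sup>2 = o(n)\<close> and \<open>E (W n)\<^sup>2 = O(n)\<close> uniformly in \<open>\<theta>\<close>; dominated
  convergence in \<open>\<theta>\<close> and the Cauchy-Schwarz inequality then bound the variance of
  \<open>L n - 2 * (S n \<bullet> u)\<close> by \<open>o(n)\<close>.

  For Cauchy's formula, a line orthogonal to \<open>e \<theta>\<close> through the interior of a polygon and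
  missing its vertices meets exactly two edges, so the projections of the edges onto \<open>e \<theta>\<close> have total
  length twice the width.\<close>

section \<open>Cauchy's perimeter formula\<close>

text \<open>A supporting line at \<open>x\<close> cuts out a face \<open>F\<close> that is at most
  one-dimensional, hence a segment whose ends are extreme in \<open>K\<close>. Extreme points
  \<open>a\<close>, \<open>b\<close> with \<open>x\<close> strictly between them must both lie in
  the face \<open>F\<close>, and the only extreme points there are \<open>p\<close> and
  \<open>q\<close>. The case \<open>p = q\<close> is allowed.\<close>

lemma frontier_point_edge:
  fixes K :: "(real^2) set"
  assumes K: "compact K" "convex K" "interior K \<noteq> {}" and x: "x \<in> frontier K"
  obtains p q where "p extreme_point_of K" "q extreme_point_of K" "x \<in> closed_segment p q"
    "closed_segment p q \<subseteq> frontier K"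
    "\<And>a b. a extreme_point_of K \<Longrightarrow> b extreme_point_of K \<Longrightarrow> x \<in> open_segment a b \<Longrightarrow> {a, b} = {p, q}"
proof -
  have cl: "closure K = K" using K(1) by (simp add: compact_imp_closed)
  have xK: "x \<in> K" using x cl by (auto simp: frontier_def)
  obtain c where c0: "c \<noteq> 0" and c: "\<And>y. y \<in> K \<Longrightarrow> c \<bullet> x \<le> c \<bullet> y"
  proof -
    have ri: "rel_interior K = interior K" using K(3) by (simp add: rel_interior_nonempty_interior)
    have "x \<notin> rel_interior K" using x ri by (simp add: frontier_def)
    from supporting_hyperplane_rel_boundary[OF K(2) xK this] that show ?thesis
      using K(2) ri closure_subset[of K] by (metis rel_interior_eq_empty subsetD)
  qed
  define F where "F = K \<inter> {y. c \<bullet> y = c \<bullet> x}"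
  have F: "F face_of K" unfolding F_def
    using K(2) c by (intro face_of_Int_supporting_hyperplane_ge) auto
  have "aff_dim F \<le> aff_dim {y. c \<bullet> y = c \<bullet> x}" unfolding F_def by (intro aff_dim_subset) auto
  also have "\<dots> = 1" using c0 by simp
  finally have "collinear F" by (simp add: collinear_aff_dim)
  moreover have "compact F" "convex F" using F K face_of_imp_compact face_of_imp_convex by blast+
  moreover have xF: "x \<in> F" using xK by (simp add: F_def)
  ultimately obtain p q where pq: "F = closed_segment p q"
    using compact_convex_collinear_segment by (metis empty_iff)
  \<comment> \<open>\<open>F\<close> lies in a line and so is a proper face, and a proper face of a
    convex set avoids its interior.\<close>
  have "interior F = {}"
    using interior_mono[of F "{y. c \<bullet> y = c \<bullet> x}"] interior_hyperplane[OF c0] by (auto simp: F_def)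
  then have "F \<noteq> K" using K(3) by auto
  then have "F \<inter> interior K = {}" using face_of_disjoint_interior F by blast
  moreover have "F \<subseteq> K" by (simp add: F_def)
  ultimately have Ff: "F \<subseteq> frontier K" using cl by (auto simp: frontier_def)
  have ext: "z extreme_point_of K \<and> z \<in> F \<longleftrightarrow> z = p \<or> z = q" for z
    using extreme_point_of_face[OF F, of z] extreme_point_of_segment[of z p q] pq by simp
  show ?thesis
  proof
    show "p extreme_point_of K" "q extreme_point_of K" using ext by blast+
    show "x \<in> closed_segment p q" "closed_segment p q \<subseteq> frontier K" using pq xF Ff by auto
    fix a b assume ab: "a extreme_point_of K" "b extreme_point_of K" "x \<in> open_segment a b"
    then have "a \<in> K" "b \<in> K" by (auto simp: extreme_point_of_def)
    then have "a \<in> F" "b \<in> F" using face_ofD[OF F] ab(3) xF by blast+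
    then have "a \<in> {p, q}" "b \<in> {p, q}" using ext ab by blast+
    moreover have "a \<noteq> b" using ab(3) by auto
    ultimately show "{a, b} = {p, q}" by blast
  qed
qed

text \<open>The chord cut out by the line passes through an interior point \<open>c\<close>. Its
  ends cannot be interior, since the chord could then be prolonged, while every other point of it is
  \<open>c\<close> or lies strictly between \<open>c\<close> and an end, hence is interior. The
  chord contains \<open>c\<close>, so it does not run along the frontier.\<close>

lemma line_frontier_two_points:
  fixes K :: "(real^2) set"
  assumes K: "compact K" "convex K" "interior K \<noteq> {}" and u: "u \<noteq> 0"
    and x0: "x0 \<in> K" "x0 \<bullet> u < t" and x1: "x1 \<in> K" "t < x1 \<bullet> u"
  obtains y z where "frontier K \<inter> {x. x \<bullet> u = t} = {y, z}" "y \<noteq> z" "\<not> closed_segment y z \<subseteq> frontier K"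
proof -
  have cl: "closure K = K" using K(1) by (simp add: compact_imp_closed)
  \<comment> \<open>\<open>K\<close> is the closure of its interior, so the strict inequalities at
    \<open>x0\<close> and \<open>x1\<close> carry over to interior points.\<close>
  have dense: "\<exists>c. c \<in> interior K \<inter> U" if "x \<in> K" "x \<in> U" "open U" for x U
  proof -
    have "x \<in> closure (interior K)" using convex_closure_interior[OF K(2,3)] cl that by simp
    then show ?thesis using that open_Int_closure_eq_empty[of U "interior K"] by blast
  qed
  have op: "open {x. x \<bullet> u < t}" "open {x. x \<bullet> u > t}"
    by (auto intro!: open_Collect_less continuous_intros)
  obtain c0 where c0: "c0 \<in> interior K" "c0 \<bullet> u < t" using dense[OF x0(1) _ op(1)] x0 by auto
  obtain c1 where c1: "c1 \<in> interior K" "c1 \<bullet> u > t" using dense[OF x1(1) _ op(2)] x1 by auto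
  have "connected (interior K)" using K(2) by (simp add: convex_connected convex_interior)
  then have "connected ((\<lambda>x. x \<bullet> u) ` interior K)"
    by (intro connected_continuous_image continuous_intros)
  then have "t \<in> (\<lambda>x. x \<bullet> u) ` interior K"
    using c0 c1 connectedD_interval[of _ "c0 \<bullet> u" "c1 \<bullet> u" t] by (auto simp: less_imp_le)
  then obtain c where c: "c \<in> interior K" "c \<bullet> u = t" by auto
  define F where "F = K \<inter> {x. u \<bullet> x = t}"
  have "aff_dim F \<le> aff_dim {x. u \<bullet> x = t}" unfolding F_def by (intro aff_dim_subset) auto
  also have "\<dots> = 1" using u by simp
  finally have "collinear F" by (simp add: collinear_aff_dim)
  moreover have "compact F" "convex F" unfolding F_def using K
    by (auto intro!: compact_Int_closed closed_hyperplane convex_Int convex_hyperplane)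
  moreover have cF: "c \<in> F" using c interior_subset by (auto simp: F_def inner_commute)
  ultimately obtain y z where yz: "F = closed_segment y z"
    using compact_convex_collinear_segment by (metis empty_iff)
  have not_int: "w \<notin> interior K" if w: "w extreme_point_of F" for w
  proof
    assume "w \<in> interior K"
    then obtain r where r: "r > 0" "ball w r \<subseteq> K" by (metis mem_interior)
    obtain v where v: "v \<noteq> 0" "orthogonal u v"
      using orthogonal_to_vector_exists[of u] by auto
    \<comment> \<open>A vector of length \<open>r / 2\<close> along the line: \<open>w - d\<close>
      and \<open>w + d\<close> stay in the ball around \<open>w\<close> and on the chord, so
      \<open>w\<close> is a midpoint and not extreme.\<close>
    define d where "d = (r / (2 * norm v)) *\<^sub>R v"
    have d: "d \<noteq> 0" "norm d < r" "u \<bullet> d = 0" using r v by (auto simp: d_def orthogonal_def)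
    have "w \<in> F" using w by (simp add: extreme_point_of_def)
    then have "w + d \<in> F" "w - d \<in> F" using d r unfolding F_def
      by (auto simp: inner_add_right inner_diff_right subset_iff dist_norm)
    moreover have "w \<in> open_segment (w - d) (w + d)"
    proof -
      have "w = midpoint (w - d) (w + d)" by (simp add: midpoint_def scaleR_2[symmetric])
      moreover have "w - d \<noteq> w + d"
      proof
        assume "w - d = w + d"
        then have "2 *\<^sub>R d = 0" by (simp add: scaleR_2 algebra_simps)
        then show False using d by simp
      qed
      ultimately show ?thesis using midpoint_in_open_segment by metis
    qed
    ultimately show False using w by (auto simp: extreme_point_of_def)
  qed
  have n: "y \<notin> interior K" "z \<notin> interior K"
    using not_int extreme_point_of_segment yz by auto
  have mem: "y \<in> K" "z \<in> K" "y \<bullet> u = t" "z \<bullet> u = t" using yz by (auto simp: F_def inner_commute set_eq_iff)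
  have cyz: "c \<in> closed_segment y z" "c \<noteq> y" "c \<noteq> z" using yz cF c n by auto
  have int: "w \<in> interior K" if w: "w \<in> closed_segment y z" "w \<noteq> y" "w \<noteq> z" for w
  proof -
    have "w \<in> closed_segment y c \<union> closed_segment c z"
      using Un_closed_segment[OF cyz(1)] w by auto
    then consider "w = c" | "w \<in> open_segment c y" | "w \<in> open_segment c z"
      using w by (auto simp: open_segment_def closed_segment_commute)
    then show ?thesis
      using c in_interior_closure_convex_segment[OF K(2) c(1)] mem cl by cases auto
  qed
  show ?thesis
  proof
    show "y \<noteq> z" using cyz by auto
    show "\<not> closed_segment y z \<subseteq> frontier K" using cyz c by (auto simp: frontier_def)
    show "frontier K \<inter> {x. x \<bullet> u = t} = {y, z}"
    proof (intro equalityI subsetI)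
      fix x assume x: "x \<in> frontier K \<inter> {x. x \<bullet> u = t}"
      then have "x \<in> F" by (auto simp: F_def inner_commute frontier_def cl)
      then show "x \<in> {y, z}" using int x yz by (auto simp: frontier_def)
    qed (use mem n cl in \<open>auto simp: frontier_def\<close>)
  qed
qed


section \<open>Edges of a polygon and their projections to a line\<close>

lemma diameter_doubleton: "diameter {a, b} = dist a b" for a b :: "'a::real_normed_vector"
proof (rule antisym)
  show "diameter {a, b} \<le> dist a b"
    by (rule diameter_le) (auto simp: dist_norm norm_minus_commute)
  show "dist a b \<le> diameter {a, b}"
    by (rule diameter_bounded_bound) auto
qed

lemma diameter_closed_segment: "diameter (closed_segment a b) = dist a b" for a b :: "'a::euclidean_space"
proof (rule antisym)
  show "diameter (closed_segment a b) \<le> dist a b"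
  proof (rule diameter_le)
    fix x y assume "x \<in> closed_segment a b" "y \<in> closed_segment a b"
    then show "norm (x - y) \<le> dist a b"
      using dist_decreases_closed_segment[of x a b y] dist_in_closed_segment[of y a b]
      by (auto simp: dist_norm norm_minus_commute)
  qed simp
  show "dist a b \<le> diameter (closed_segment a b)"
    by (rule diameter_bounded_bound) (auto intro: bounded_closed_segment)
qed

text \<open>The index set of the sum in \<open>perimeter\<close>. An edge is kept as its unordered
  pair of end points; the segment itself is \<open>convex hull e\<close>.\<close>

definition edges :: "(real^2) set \<Rightarrow> (real^2) set set" where
  "edges K = {{a, b} | a b. a extreme_point_of K \<and> b extreme_point_of K \<and> a \<noteq> b
                               \<and> closed_segment a b \<subseteq> frontier K}"

lemma edgesE:
  assumes "e \<in> edges K"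
  obtains a b where "e = {a, b}" "a extreme_point_of K" "b extreme_point_of K" "a \<noteq> b"
    "closed_segment a b \<subseteq> frontier K"
  using assms by (auto simp: edges_def)

text \<open>A non-extreme point lies strictly between the ends of every edge through it, and
  \<open>frontier_point_edge\<close> determines such a pair of ends.\<close>

lemma frontier_point_unique_edge:
  fixes K :: "(real^2) set"
  assumes K: "compact K" "convex K" "interior K \<noteq> {}" and x: "x \<in> frontier K" "\<not> x extreme_point_of K"
  obtains e where "e \<in> edges K" "x \<in> convex hull e"
    "\<And>e'. e' \<in> edges K \<Longrightarrow> x \<in> convex hull e' \<Longrightarrow> e' = e"
proof -
  obtain p q where pq: "p extreme_point_of K" "q extreme_point_of K" "x \<in> closed_segment p q"
    "closed_segment p q \<subseteq> frontier K"
    and uniq: "\<And>a b. a extreme_point_of K \<Longrightarrow> b extreme_point_of K \<Longrightarrow> x \<in> open_segment a b \<Longrightarrow> {a, b} = {p, q}"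
    using frontier_point_edge[OF K x(1)] by metis
  have "p \<noteq> q" using pq x(2) by auto
  show ?thesis
  proof
    show "{p, q} \<in> edges K" using pq \<open>p \<noteq> q\<close> by (auto simp: edges_def)
    show "x \<in> convex hull {p, q}" using pq(3) by (simp add: segment_convex_hull)
    fix e' assume e': "e' \<in> edges K" "x \<in> convex hull e'"
    then obtain a b where ab: "e' = {a, b}" "a extreme_point_of K" "b extreme_point_of K" by (auto elim: edgesE)
    then have "x \<in> open_segment a b"
      using e'(2) x(2) by (auto simp: open_segment_def segment_convex_hull)
    then show "e' = {p, q}" using uniq ab by blast
  qed
qed

text \<open>Along the segment \<open>x \<bullet> u\<close> is an affine function of the parameter;
  taking the value \<open>t\<close> at two parameters would make it constant, which its value at
  \<open>a\<close> excludes.\<close>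

lemma segment_meets_line_once:
  fixes a b u :: "'a::real_inner"
  assumes "x \<in> closed_segment a b" "y \<in> closed_segment a b" "x \<bullet> u = t" "y \<bullet> u = t" "a \<bullet> u \<noteq> t"
  shows "x = y"
proof -
  obtain r s where r: "x = (1 - r) *\<^sub>R a + r *\<^sub>R b" and s: "y = (1 - s) *\<^sub>R a + s *\<^sub>R b"
    using assms(1,2) by (auto simp: closed_segment_def)
  have "(1 - r) * (a \<bullet> u) + r * (b \<bullet> u) = t" "(1 - s) * (a \<bullet> u) + s * (b \<bullet> u) = t"
    using assms(3,4) by (auto simp: r s inner_add_left)
  then have "a \<bullet> u + r * (b \<bullet> u - a \<bullet> u) = t" "(r - s) * (b \<bullet> u - a \<bullet> u) = 0" by (auto simp: algebra_simps)
  then have "r = s" using assms(5) by auto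
  then show ?thesis using r s by simp
qed

text \<open>The line meets the frontier in two points, neither of them a vertex, so each lies on
  exactly one edge. The two edges differ because an edge with an end off the line meets the line at
  most once.\<close>

lemma two_edges_meet_line:
  fixes K :: "(real^2) set"
  assumes K: "compact K" "convex K" "interior K \<noteq> {}" and u: "u \<noteq> 0"
    and x0: "x0 \<in> K" "x0 \<bullet> u < t" and x1: "x1 \<in> K" "t < x1 \<bullet> u"
    and t: "\<And>x. x extreme_point_of K \<Longrightarrow> x \<bullet> u \<noteq> t"
  shows "card {e \<in> edges K. \<exists>x \<in> convex hull e. x \<bullet> u = t} = 2"
proof -
  obtain y z where yz: "frontier K \<inter> {x. x \<bullet> u = t} = {y, z}" "y \<noteq> z" "\<not> closed_segment y z \<subseteq> frontier K"
    using line_frontier_two_points[OF K u x0 x1] by metis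
  have y: "y \<in> frontier K" "y \<bullet> u = t" and z: "z \<in> frontier K" "z \<bullet> u = t" using yz(1) by auto
  have ny: "\<not> y extreme_point_of K" and nz: "\<not> z extreme_point_of K" using t y(2) z(2) by blast+
  obtain e where e: "e \<in> edges K" "y \<in> convex hull e" "\<And>e'. e' \<in> edges K \<Longrightarrow> y \<in> convex hull e' \<Longrightarrow> e' = e"
    using frontier_point_unique_edge[OF K y(1) ny] by blast
  obtain f where f: "f \<in> edges K" "z \<in> convex hull f" "\<And>e'. e' \<in> edges K \<Longrightarrow> z \<in> convex hull e' \<Longrightarrow> e' = f"
    using frontier_point_unique_edge[OF K z(1) nz] by blast
  have "e \<noteq> f"
  proof
    assume "e = f"
    obtain a b where ab: "e = {a, b}" "a extreme_point_of K" using e(1) by (auto elim: edgesE)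
    have "y \<in> closed_segment a b" "z \<in> closed_segment a b"
      using e(2) f(2) unfolding \<open>e = f\<close>[symmetric] ab(1) segment_convex_hull by simp_all
    then have "y = z" using segment_meets_line_once y(2) z(2) t[OF ab(2)] by blast
    then show False using yz by simp
  qed
  moreover have "{e \<in> edges K. \<exists>x \<in> convex hull e. x \<bullet> u = t} = {e, f}"
  proof (intro equalityI subsetI)
    fix g assume g: "g \<in> {e \<in> edges K. \<exists>x \<in> convex hull e. x \<bullet> u = t}"
    then obtain x where x: "x \<in> convex hull g" "x \<bullet> u = t" by auto
    have "convex hull g \<subseteq> frontier K" using g by (auto elim!: edgesE simp: segment_convex_hull)
    then have "x \<in> {y, z}" using x yz(1) by blast
    then show "g \<in> {e, f}" using x(1) g e(3) f(3) by blast
  qed (use e(1,2) f(1,2) y(2) z(2) in blast)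
  ultimately show ?thesis by simp
qed

text \<open>Both sides are the integral over \<open>t\<close> of the number of edges that meet the
  line at level \<open>t\<close>: for almost every \<open>t\<close> this number is 2 between the
  extreme levels and 0 outside.\<close>

lemma edge_projections:
  fixes K :: "(real^2) set"
  assumes K: "compact K" "convex K" "interior K \<noteq> {}" and fin: "finite {x. x extreme_point_of K}"
    and u: "u \<noteq> 0"
    and x0: "x0 \<in> K" "\<And>x. x \<in> K \<Longrightarrow> x0 \<bullet> u \<le> x \<bullet> u" and x1: "x1 \<in> K" "\<And>x. x \<in> K \<Longrightarrow> x \<bullet> u \<le> x1 \<bullet> u"
  shows "(\<Sum>e\<in>edges K. diameter ((\<lambda>x. x \<bullet> u) ` e)) = 2 * (x1 \<bullet> u - x0 \<bullet> u)"
proof -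
  \<comment> \<open>The exceptional levels: those of the vertices, where the count can fail, and the
    two extreme ones. They form a finite set, hence a null set.\<close>
  define V where "V = insert (x0 \<bullet> u) (insert (x1 \<bullet> u) ((\<lambda>x. x \<bullet> u) ` {x. x extreme_point_of K}))"
  have finV: "finite V" using fin by (simp add: V_def)
  have finE: "finite (edges K)"
    by (rule finite_subset[of _ "Pow {x. x extreme_point_of K}"]) (use fin in \<open>auto simp: edges_def\<close>)
  define P where "P e = (\<lambda>x. x \<bullet> u) ` (convex hull e)" for e :: "(real^2) set"
  have P: "\<exists>a b. P e = {a..b} \<and> a \<le> b \<and> diameter ((\<lambda>x. x \<bullet> u) ` e) = b - a" if "e \<in> edges K" for e
  proof -
    obtain a b where ab: "e = {a, b}" using \<open>e \<in> edges K\<close> by (auto elim: edgesE)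
    have lin: "linear (\<lambda>x. x \<bullet> u)" by (simp add: bounded_linear.linear bounded_linear_inner_left)
    have "P e = closed_segment (a \<bullet> u) (b \<bullet> u)"
      unfolding P_def ab segment_convex_hull[symmetric] using closed_segment_linear_image[OF lin] by simp
    moreover have "diameter {a \<bullet> u, b \<bullet> u} = \<bar>a \<bullet> u - b \<bullet> u\<bar>"
      by (simp add: diameter_doubleton dist_real_def)
    ultimately show ?thesis unfolding ab by (auto simp: closed_segment_eq_real_ivl abs_if)
  qed
  have int: "integrable lborel (indicat_real (P e))"
    and val: "(LINT t|lborel. indicat_real (P e) t) = diameter ((\<lambda>x. x \<bullet> u) ` e)" if "e \<in> edges K" for e
    using P[OF that] by (auto simp: integrable_real_indicator)
  have "(\<Sum>e\<in>edges K. diameter ((\<lambda>x. x \<bullet> u) ` e)) = (LINT t|lborel. (\<Sum>e\<in>edges K. indicat_real (P e) t))"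
    using int val by (simp add: Bochner_Integration.integral_sum)
  also have "\<dots> = (LINT t|lborel. 2 * indicat_real {x0 \<bullet> u..x1 \<bullet> u} t)"
  proof (rule integral_cong_AE)
    show "(\<lambda>t. \<Sum>e\<in>edges K. indicat_real (P e) t) \<in> borel_measurable lborel"
      using int by (intro borel_measurable_sum) (auto intro: borel_measurable_integrable)
    show "(\<lambda>t. 2 * indicat_real {x0 \<bullet> u..x1 \<bullet> u} t) \<in> borel_measurable lborel" by measurable
    have "AE t in lborel. t \<notin> V" using finite_imp_null_set_lborel[OF finV] AE_not_in by blast
    then show "AE t in lborel. (\<Sum>e\<in>edges K. indicat_real (P e) t) = 2 * indicat_real {x0 \<bullet> u..x1 \<bullet> u} t"
    proof eventually_elim
      case (elim t)
      have "(\<Sum>e\<in>edges K. indicat_real (P e) t) = real (card {e \<in> edges K. t \<in> P e})"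
        using finE by (simp add: indicator_def sum.If_cases Int_def)
      also have "{e \<in> edges K. t \<in> P e} = {e \<in> edges K. \<exists>x \<in> convex hull e. x \<bullet> u = t}"
        by (auto simp: P_def)
      also have "real (card \<dots>) = 2 * indicat_real {x0 \<bullet> u..x1 \<bullet> u} t"
      proof (cases "x0 \<bullet> u < t \<and> t < x1 \<bullet> u")
        case True
        then show ?thesis
          using two_edges_meet_line[OF K u x0(1) _ x1(1), of t] elim by (fastforce simp: V_def)
      next
        case False
        have "\<not> (\<exists>x \<in> convex hull e. x \<bullet> u = t)" if e: "e \<in> edges K" for e
        proof -
          have "convex hull e \<subseteq> K"
            using e K(1) frontier_subset_closed[of K] by (fastforce elim!: edgesE simp: segment_convex_hull compact_imp_closed)
          then show ?thesis using False elim x0 x1 unfolding V_def by fastforce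
        qed
        then have "{e \<in> edges K. \<exists>x \<in> convex hull e. x \<bullet> u = t} = {}" by blast
        then have "card {e \<in> edges K. \<exists>x \<in> convex hull e. x \<bullet> u = t} = 0" by (metis card.empty)
        moreover have "t \<notin> {x0 \<bullet> u..x1 \<bullet> u}" using False elim by (auto simp: V_def)
        ultimately show ?thesis by (metis indicator_simps(2) mult_zero_right of_nat_0)
      qed
      finally show ?case .
    qed
  qed
  also have "\<dots> = 2 * (x1 \<bullet> u - x0 \<bullet> u)" using x0(2)[OF x1(1)] by simp
  finally show ?thesis .
qed

section \<open>Integrals of projections over a half circle of directions\<close>

definition direction :: "real^2 \<Rightarrow> real \<Rightarrow> real^2" where
  "direction u \<theta> = cos \<theta> *\<^sub>R u + sin \<theta> *\<^sub>R vector [- u $ 2, u $ 1]"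

lemma inner_real2: "x \<bullet> y = x $ 1 * y $ 1 + x $ 2 * y $ 2" for x y :: "real^2"
  by (simp add: inner_vec_def sum_2)

lemma inner_direction:
  "x \<bullet> direction u \<theta> = (x \<bullet> u) * cos \<theta> + (x $ 2 * u $ 1 - x $ 1 * u $ 2) * sin \<theta>"
  by (simp add: direction_def inner_add_right inner_real2 algebra_simps)

text \<open>Pythagoras in the orthonormal basis formed by \<open>u\<close> and its quarter turn; the
  last bracket is the coordinate along the quarter turn.\<close>

lemma norm_real2_rotated:
  fixes x u :: "real^2"
  assumes "norm u = 1"
  shows "(norm x)\<^sup>2 = (x \<bullet> u)\<^sup>2 + (x $ 2 * u $ 1 - x $ 1 * u $ 2)\<^sup>2"
proof -
  have "(norm x)\<^sup>2 = (norm x)\<^sup>2 * (norm u)\<^sup>2" using assms by simp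
  then show ?thesis unfolding power2_norm_eq_inner inner_real2 by (simp add: power2_eq_square algebra_simps)
qed

lemma norm_direction:
  assumes "norm u = 1"
  shows "norm (direction u \<theta>) = 1"
proof -
  have "(norm (direction u \<theta>))\<^sup>2 = direction u \<theta> \<bullet> direction u \<theta>" by (simp add: power2_norm_eq_inner)
  also have "\<dots> = ((cos \<theta>)\<^sup>2 + (sin \<theta>)\<^sup>2) * (u \<bullet> u)"
    by (simp add: direction_def inner_real2 power2_eq_square algebra_simps
        del: sin_cos_squared_add sin_cos_squared_add2 sin_cos_squared_add3)
  also have "\<dots> = 1" using assms by (simp add: norm_eq_1)
  finally show ?thesis by (simp add: power2_eq_1_iff)
       (metis norm_ge_zero neg_0_le_iff_le not_one_le_zero order.trans zero_le_one)
qed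

lemma continuous_on_direction [continuous_intros]: "continuous_on A (direction u)"
  unfolding direction_def by (intro continuous_intros)

lemma continuous_on_Max_image:
  fixes f :: "'a::topological_space \<Rightarrow> 'b \<Rightarrow> real"
  assumes "finite P" "P \<noteq> {}" "\<And>p. p \<in> P \<Longrightarrow> continuous_on A (\<lambda>x. f x p)"
  shows "continuous_on A (\<lambda>x. Max (f x ` P))"
  using assms by (induction rule: finite_ne_induct) (auto intro!: continuous_intros)

lemma continuous_on_Min_image:
  fixes f :: "'a::topological_space \<Rightarrow> 'b \<Rightarrow> real"
  assumes "finite P" "P \<noteq> {}" "\<And>p. p \<in> P \<Longrightarrow> continuous_on A (\<lambda>x. f x p)"
  shows "continuous_on A (\<lambda>x. Min (f x ` P))"
  using assms by (induction rule: finite_ne_induct) (auto intro!: continuous_intros)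

lemma has_integral_abs_cos:
  assumes "0 \<le> \<phi>" "\<phi> \<le> pi"
  shows "((\<lambda>\<theta>. \<bar>cos (\<theta> - \<phi>)\<bar>) has_integral 2) {-pi/2..pi/2}"
proof -
  \<comment> \<open>The cosine changes sign here; the two pieces contribute
    \<open>1 - cos \<phi>\<close> and \<open>1 + cos \<phi>\<close>.\<close>
  let ?m = "\<phi> - pi/2"
  have der: "((\<lambda>\<theta>. sin (\<theta> - \<phi>)) has_vector_derivative cos (\<theta> - \<phi>)) (at \<theta> within S)" for \<theta> S
    by (auto intro!: derivative_eq_intros simp: has_real_derivative_iff_has_vector_derivative[symmetric])
  have 1: "((\<lambda>\<theta>. - cos (\<theta> - \<phi>)) has_integral - (sin (?m - \<phi>) - sin (-pi/2 - \<phi>))) {-pi/2..?m}"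
    using assms der by (intro has_integral_neg fundamental_theorem_of_calculus) auto
  have 2: "((\<lambda>\<theta>. cos (\<theta> - \<phi>)) has_integral (sin (pi/2 - \<phi>) - sin (?m - \<phi>))) {?m..pi/2}"
    using assms der by (intro fundamental_theorem_of_calculus) auto
  have 1: "((\<lambda>\<theta>. \<bar>cos (\<theta> - \<phi>)\<bar>) has_integral - (sin (?m - \<phi>) - sin (-pi/2 - \<phi>))) {-pi/2..?m}"
  proof (rule has_integral_eq[OF _ 1])
    fix \<theta> assume "\<theta> \<in> {-pi/2..?m}"
    then have "0 \<le> cos (\<theta> - \<phi> + pi)" using assms by (intro cos_ge_zero) auto
    then show "- cos (\<theta> - \<phi>) = \<bar>cos (\<theta> - \<phi>)\<bar>" by simp
  qed
  have 2: "((\<lambda>\<theta>. \<bar>cos (\<theta> - \<phi>)\<bar>) has_integral (sin (pi/2 - \<phi>) - sin (?m - \<phi>))) {?m..pi/2}"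
  proof (rule has_integral_eq[OF _ 2])
    fix \<theta> assume "\<theta> \<in> {?m..pi/2}"
    then have "0 \<le> cos (\<theta> - \<phi>)" using assms by (intro cos_ge_zero) auto
    then show "cos (\<theta> - \<phi>) = \<bar>cos (\<theta> - \<phi>)\<bar>" by simp
  qed
  have e: "sin (?m - \<phi>) = -1" "sin (pi/2 - \<phi>) = cos \<phi>" "sin (-pi/2 - \<phi>) = - cos \<phi>"
    by (simp_all add: sin_diff)
  show ?thesis using has_integral_combine[OF _ _ 1 2] assms unfolding e by simp
qed

text \<open>In polar coordinates relative to \<open>u\<close> the integrand is
  \<open>norm x * \<bar>cos (\<theta> - \<phi>)\<bar>\<close>. Since \<open>x\<close> and
  \<open>- x\<close> have the same absolute projections, the angle may be taken in the upper half
  circle, as \<open>has_integral_abs_cos\<close> requires.\<close>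

lemma has_integral_abs_inner_direction:
  assumes u: "norm u = 1"
  shows "((\<lambda>\<theta>. \<bar>x \<bullet> direction u \<theta>\<bar>) has_integral 2 * norm x) {-pi/2..pi/2}"
proof -
  have main: "((\<lambda>\<theta>. \<bar>x \<bullet> direction u \<theta>\<bar>) has_integral 2 * norm x) {-pi/2..pi/2}"
    if nn: "0 \<le> x $ 2 * u $ 1 - x $ 1 * u $ 2" for x
  proof (cases "x = 0")
    case False
    define A B where "A = (x \<bullet> u) / norm x" and "B = (x $ 2 * u $ 1 - x $ 1 * u $ 2) / norm x"
    have "A\<^sup>2 + B\<^sup>2 = 1" "B \<ge> 0"
      using norm_real2_rotated[OF u, of x] False nn
      by (auto simp: A_def B_def power_divide add_divide_distrib[symmetric])
    then obtain \<phi> where \<phi>: "0 \<le> \<phi>" "\<phi> \<le> pi" "A = cos \<phi>" "B = sin \<phi>"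
      using sincos_total_pi by metis
    have "\<bar>x \<bullet> direction u \<theta>\<bar> = norm x * \<bar>cos (\<theta> - \<phi>)\<bar>" for \<theta>
    proof -
      have "x \<bullet> direction u \<theta> = norm x * (A * cos \<theta> + B * sin \<theta>)"
        using False by (simp add: inner_direction A_def B_def distrib_left)
      also have "A * cos \<theta> + B * sin \<theta> = cos (\<theta> - \<phi>)" by (simp add: \<phi> cos_diff)
      finally show ?thesis by (simp add: abs_mult)
    qed
    then show ?thesis using has_integral_mult_right[OF has_integral_abs_cos[OF \<phi>(1,2)], of "norm x"]
      by (simp add: mult.commute)
  qed simp
  show ?thesis
  proof (cases "0 \<le> x $ 2 * u $ 1 - x $ 1 * u $ 2")
    case False
    then have "0 \<le> (- x) $ 2 * u $ 1 - (- x) $ 1 * u $ 2" by simp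
    from main[OF this] show ?thesis by simp
  qed (rule main)
qed

lemma inner_image_convex_hull_bounds:
  fixes P :: "'a::real_inner set"
  assumes "finite P" "P \<noteq> {}"
  obtains x0 x1 where "x0 \<in> convex hull P" "x1 \<in> convex hull P"
    "x0 \<bullet> u = Min ((\<lambda>p. p \<bullet> u) ` P)" "x1 \<bullet> u = Max ((\<lambda>p. p \<bullet> u) ` P)"
    "\<And>x. x \<in> convex hull P \<Longrightarrow> x0 \<bullet> u \<le> x \<bullet> u \<and> x \<bullet> u \<le> x1 \<bullet> u"
proof -
  let ?P = "(\<lambda>p. p \<bullet> u) ` P"
  have "Min ?P \<in> ?P" "Max ?P \<in> ?P" using assms by (auto intro!: Min_in Max_in)
  then obtain x0 x1 where x: "x0 \<in> P" "x1 \<in> P" "x0 \<bullet> u = Min ?P" "x1 \<bullet> u = Max ?P" by auto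
  have "convex hull P \<subseteq> {x. u \<bullet> x \<ge> Min ?P} \<inter> {x. u \<bullet> x \<le> Max ?P}"
    using assms by (intro hull_minimal convex_Int convex_halfspace_le convex_halfspace_ge)
      (use assms in \<open>auto simp: inner_commute[of u] intro!: Min_le Max_ge\<close>)
  then show ?thesis using x by (intro that[of x0 x1]) (auto simp: hull_inc inner_commute)
qed

text \<open>For a polygon the width is half the total projection of the edges, and each edge
  contributes its length after integration. For a degenerate hull, a segment from \<open>a\<close>
  to \<open>b\<close>, the width is the projection of \<open>a - b\<close>, which integrates to
  twice the length, in accordance with the convention in \<open>perimeter\<close>.\<close>

lemma has_integral_width_perimeter:
  fixes P :: "(real^2) set"
  assumes P: "finite P" "P \<noteq> {}" and u: "norm u = 1"
  shows "((\<lambda>\<theta>. Max ((\<lambda>p. p \<bullet> direction u \<theta>) ` P) - Min ((\<lambda>p. p \<bullet> direction u \<theta>) ` P))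
    has_integral perimeter (convex hull P)) {-pi/2..pi/2}"
proof (cases "interior (convex hull P) = {}")
  case True
  let ?K = "convex hull P"
  have K: "compact ?K" "convex ?K" using P by (simp_all add: compact_convex_hull finite_imp_compact)
  \<comment> \<open>Without interior points the hull has dimension at most one and is therefore a
    segment, possibly a single point.\<close>
  have "aff_dim ?K \<noteq> int DIM(real^2)"
    using True K(2) P(2) rel_interior_eq_empty[of ?K] by (auto simp: interior_rel_interior_gen)
  then have "aff_dim ?K \<le> 1" using aff_dim_le_DIM[of ?K] by simp
  then obtain a b where ab: "?K = closed_segment a b"
    using compact_convex_collinear_segment[of ?K] K P(2) by (auto simp: collinear_aff_dim)
  have "Max ((\<lambda>p. p \<bullet> w) ` P) - Min ((\<lambda>p. p \<bullet> w) ` P) = \<bar>(a - b) \<bullet> w\<bar>" for w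
  proof -
    obtain x0 x1 where x: "x0 \<in> ?K" "x1 \<in> ?K" "x0 \<bullet> w = Min ((\<lambda>p. p \<bullet> w) ` P)" "x1 \<bullet> w = Max ((\<lambda>p. p \<bullet> w) ` P)"
      "\<And>x. x \<in> ?K \<Longrightarrow> x0 \<bullet> w \<le> x \<bullet> w \<and> x \<bullet> w \<le> x1 \<bullet> w"
      using inner_image_convex_hull_bounds[OF P, of w] by blast
    have 1: "\<bar>(a - b) \<bullet> w\<bar> \<le> x1 \<bullet> w - x0 \<bullet> w"
      using x(5)[of a] x(5)[of b] unfolding ab by (auto simp: inner_diff_left)
    have lin: "linear (\<lambda>x. x \<bullet> w)" by (simp add: bounded_linear.linear bounded_linear_inner_left)
    have "x0 \<bullet> w \<in> closed_segment (a \<bullet> w) (b \<bullet> w)" "x1 \<bullet> w \<in> closed_segment (a \<bullet> w) (b \<bullet> w)"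
      using x(1,2) unfolding ab closed_segment_linear_image[OF lin] by auto
    then have "x1 \<bullet> w - x0 \<bullet> w \<le> \<bar>(a - b) \<bullet> w\<bar>"
      by (auto simp: closed_segment_eq_real_ivl inner_diff_left split: if_splits)
    then show ?thesis using 1 x by linarith
  qed
  moreover have "perimeter ?K = 2 * norm (a - b)"
    using True ab by (simp add: perimeter_def diameter_closed_segment dist_norm)
  ultimately show ?thesis using has_integral_abs_inner_direction[OF u, of "a - b"] by simp
next
  case False
  let ?K = "convex hull P"
  have K: "compact ?K" "convex ?K" using P by (simp_all add: compact_convex_hull finite_imp_compact)
  have fin: "finite {x. x extreme_point_of ?K}"
    by (rule finite_subset[OF _ P(1)]) (auto dest: extreme_point_of_convex_hull)
  have finE: "finite (edges ?K)"
    by (rule finite_subset[of _ "Pow {x. x extreme_point_of ?K}"]) (use fin in \<open>auto simp: edges_def\<close>)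
  have "Max ((\<lambda>p. p \<bullet> direction u \<theta>) ` P) - Min ((\<lambda>p. p \<bullet> direction u \<theta>) ` P)
     = (\<Sum>e\<in>edges ?K. diameter ((\<lambda>x. x \<bullet> direction u \<theta>) ` e) / 2)" for \<theta>
  proof -
    let ?w = "direction u \<theta>"
    obtain x0 x1 where x: "x0 \<in> ?K" "x1 \<in> ?K" "x0 \<bullet> ?w = Min ((\<lambda>p. p \<bullet> ?w) ` P)" "x1 \<bullet> ?w = Max ((\<lambda>p. p \<bullet> ?w) ` P)"
      "\<And>x. x \<in> ?K \<Longrightarrow> x0 \<bullet> ?w \<le> x \<bullet> ?w \<and> x \<bullet> ?w \<le> x1 \<bullet> ?w"
      using inner_image_convex_hull_bounds[OF P, of ?w] by blast
    have "?w \<noteq> 0" using norm_direction[OF u, of \<theta>] by auto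
    then show ?thesis using edge_projections[OF K False fin _ x(1) _ x(2), of ?w] x
      by (simp add: sum_divide_distrib[symmetric])
  qed
  moreover have "((\<lambda>\<theta>. \<Sum>e\<in>edges ?K. diameter ((\<lambda>x. x \<bullet> direction u \<theta>) ` e) / 2)
    has_integral (\<Sum>e\<in>edges ?K. diameter e)) {-pi/2..pi/2}"
  proof (rule has_integral_sum[OF finE])
    fix e assume "e \<in> edges ?K"
    then obtain a b where ab: "e = {a, b}" by (auto elim: edgesE)
    have "diameter ((\<lambda>x. x \<bullet> w) ` e) / 2 = \<bar>(a - b) \<bullet> w\<bar> / 2" for w
      by (simp add: ab diameter_doubleton dist_real_def inner_diff_left)
    then show "((\<lambda>\<theta>. diameter ((\<lambda>x. x \<bullet> direction u \<theta>) ` e) / 2) has_integral diameter e) {-pi/2..pi/2}"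
      using has_integral_divide[OF has_integral_abs_inner_direction[OF u, of "a - b"], of 2]
      by (simp add: ab diameter_doubleton dist_norm)
  qed
  ultimately show ?thesis using False by (simp add: perimeter_def edges_def)
qed

section \<open>The Lindley recursion\<close>

text \<open>The walk with steps \<open>x 1\<close>, \<open>x 2\<close>, ... kept nonnegative by
  resetting it to 0, known as the waiting times of a single-server queue.\<close>

fun lindley :: "(nat \<Rightarrow> real) \<Rightarrow> nat \<Rightarrow> real" where
  "lindley x 0 = 0"
| "lindley x (Suc n) = max 0 (lindley x n + x (Suc n))"

lemma lindley_nonneg: "0 \<le> lindley x n"
  by (cases n) auto

lemma lindley_cong: "(\<And>i. i \<in> {1..n} \<Longrightarrow> x i = y i) \<Longrightarrow> lindley x n = lindley y n"
  by (induction n) auto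

text \<open>A new step adds \<open>x (Suc n)\<close> to every old suffix sum, and the new index
  \<open>k = Suc n\<close> contributes the empty sum 0, which is the reset.\<close>

lemma lindley_eq_Max: "lindley x n = (MAX k\<in>{0..n}. \<Sum>i = Suc k..n. x i)"
proof (induction n)
  case (Suc n)
  have "(MAX k\<in>{0..Suc n}. \<Sum>i = Suc k..Suc n. x i) = max 0 (MAX k\<in>{0..n}. \<Sum>i = Suc k..Suc n. x i)"
    unfolding atLeast0_atMost_Suc image_insert by (subst Max_insert) auto
  also have "(MAX k\<in>{0..n}. \<Sum>i = Suc k..Suc n. x i) = (MAX k\<in>{0..n}. (\<Sum>i = Suc k..n. x i) + x (Suc n))"
    by (intro arg_cong[of _ _ Max] image_cong) auto
  also have "\<dots> = (MAX k\<in>{0..n}. \<Sum>i = Suc k..n. x i) + x (Suc n)"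
    by (rule Max_add_commute) auto
  finally show ?case using Suc by simp
qed simp

text \<open>A negated suffix sum is a prefix sum minus the total, so the recursion measures how far
  the maximum of the walk exceeds its final value.\<close>

lemma lindley_last_exit:
  "lindley (\<lambda>i. - x i) n = (MAX k\<in>{0..n}. \<Sum>i = 1..k. x i) - (\<Sum>i = 1..n. x i)"
proof -
  have "(\<Sum>i = Suc k..n. - x i) = (\<Sum>i = 1..k. x i) + - (\<Sum>i = 1..n. x i)" if "k \<in> {0..n}" for k
    using that sum.ub_add_nat[of 1 k x "n - k"] by (simp add: sum_negf)
  then have "(\<lambda>k. \<Sum>i = Suc k..n. - x i) ` {0..n} = (\<lambda>k. (\<Sum>i = 1..k. x i) + - (\<Sum>i = 1..n. x i)) ` {0..n}"
    by (intro image_cong) auto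
  then have "lindley (\<lambda>i. - x i) n = (MAX k\<in>{0..n}. (\<Sum>i = 1..k. x i) + - (\<Sum>i = 1..n. x i))"
    unfolding lindley_eq_Max by (rule arg_cong)
  also have "\<dots> = (MAX k\<in>{0..n}. \<Sum>i = 1..k. x i) + - (\<Sum>i = 1..n. x i)"
    by (rule Max_add_commute) auto
  finally show ?thesis by simp
qed

text \<open>Suffixes of the reversed sequence are prefixes of the original one. The reversal depends
  on \<open>n\<close>, so this identifies only the \<open>n\<close>-th value of the
  recursion.\<close>

lemma lindley_reversed:
  "lindley (\<lambda>i. - x (Suc n - i)) n = - (MIN k\<in>{0..n}. \<Sum>i = 1..k. x i)"
proof -
  have e: "(\<Sum>i = Suc k..n. - x (Suc n - i)) = - (\<Sum>i = 1..n - k. x i)" if "k \<in> {0..n}" for k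
    unfolding sum_negf[symmetric]
    by (rule sum.reindex_bij_witness[of _ "\<lambda>i. Suc n - i" "\<lambda>i. Suc n - i"]) (use that in auto)
  have "(\<lambda>k. \<Sum>i = Suc k..n. - x (Suc n - i)) ` {0..n} = (\<lambda>k. - (\<Sum>i = 1..n - k. x i)) ` {0..n}"
    using e by (intro image_cong) auto
  also have "\<dots> = uminus ` (\<lambda>k. \<Sum>i = 1..k. x i) ` (\<lambda>k. n - k) ` {0..n}" by (simp add: image_image)
  also have "(\<lambda>k. n - k) ` {0..n} = {0..n}"
    by (auto simp: image_iff) (metis atLeastAtMost_iff diff_diff_cancel diff_le_self le0)
  finally show ?thesis unfolding lindley_eq_Max by (simp add: minus_Min_eq_Max)
qed

section \<open>Second moments of the recursion with independent increments\<close>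

lemma measurable_lindley [measurable (raw)]:
  assumes "\<And>i. i \<in> {1..n} \<Longrightarrow> (\<lambda>\<omega>. X \<omega> i) \<in> borel_measurable N"
  shows "(\<lambda>\<omega>. lindley (X \<omega>) n) \<in> borel_measurable N"
  using assms
proof (induction n)
  case (Suc n)
  have [measurable]: "(\<lambda>\<omega>. lindley (X \<omega>) n) \<in> borel_measurable N" "(\<lambda>\<omega>. X \<omega> (Suc n)) \<in> borel_measurable N"
    using Suc by auto
  show ?case by simp
qed simp

text \<open>If \<open>w\<close> is at least \<open>2 * J\<close>, expand the square and use that
  \<open>w / J\<close> is at least 1. Otherwise the left side is nonzero only when
  \<open>w + x\<close> exceeds \<open>2 * J\<close>; it is then at most the square of
  \<open>x\<close>, and either \<open>x\<close> exceeds \<open>J\<close> or \<open>w\<close> is at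
  least \<open>J\<close>.\<close>

lemma truncated_step:
  fixes w x J :: real
  assumes "0 \<le> w" "0 < J"
  shows "(max 0 (max 0 (w + x) - 2 * J))\<^sup>2 \<le>
    (max 0 (w - 2 * J))\<^sup>2 + 2 * (max 0 (w - 2 * J) * x) + x\<^sup>2 * w / J + x\<^sup>2 * indicat_real {J<..} x"
proof (cases "w \<ge> 2 * J")
  case True
  have "x\<^sup>2 \<le> x\<^sup>2 * (w / J)" using mult_left_mono[of 1 "w / J" "x\<^sup>2"] True assms by simp
  moreover have "(max 0 (max 0 (w + x) - 2 * J))\<^sup>2 \<le> (w - 2 * J + x)\<^sup>2"
    using True assms by (auto simp: max_def power2_eq_square intro: mult_mono)
  moreover have "(w - 2 * J + x)\<^sup>2 = (w - 2 * J)\<^sup>2 + 2 * ((w - 2 * J) * x) + x\<^sup>2"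
    by (simp add: power2_eq_square algebra_simps)
  moreover have "0 \<le> x\<^sup>2 * indicat_real {J<..} x" by simp
  moreover have "max 0 (w - 2 * J) = w - 2 * J" using True by simp
  ultimately show ?thesis by (simp only: times_divide_eq_right)
next
  case False
  have nn: "0 \<le> x\<^sup>2 * w / J" "0 \<le> x\<^sup>2 * indicat_real {J<..} x" using assms by auto
  show ?thesis
  proof (cases "w + x \<le> 2 * J")
    case True
    then show ?thesis using False nn assms by (auto simp: max_def)
  next
    case big: False
    have "0 < w + x - 2 * J" "w + x - 2 * J \<le> x" using big False by auto
    then have "(max 0 (max 0 (w + x) - 2 * J))\<^sup>2 \<le> x\<^sup>2"
      using assms by (auto simp: max_def intro!: power_mono)
    also have "x\<^sup>2 \<le> x\<^sup>2 * w / J + x\<^sup>2 * indicat_real {J<..} x"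
    proof (cases "x \<le> J")
      case True
      then have "1 \<le> w / J" using big assms by simp
      then have "x\<^sup>2 * 1 \<le> x\<^sup>2 * (w / J)" by (intro mult_left_mono) auto
      then show ?thesis using nn(2) by (simp only: mult_1_right times_divide_eq_right)
    qed (use nn in auto)
    finally show ?thesis using False by (simp add: max_def)
  qed
qed

text \<open>Only the increments with index in \<open>{1..n}\<close> are constrained, so that the
  reversed sequence, which changes with \<open>n\<close>, is an instance as well.\<close>

locale lindley_walk = prob_space M for M :: "'w measure" +
  fixes X :: "nat \<Rightarrow> 'w \<Rightarrow> real" and n :: nat and a s :: real
  assumes indep: "indep_vars (\<lambda>_. borel) X {1..n}"
    and sq: "\<And>i. i \<in> {1..n} \<Longrightarrow> integrable M (\<lambda>\<omega>. (X i \<omega>)\<^sup>2)"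
    and mean: "\<And>i. i \<in> {1..n} \<Longrightarrow> expectation (X i) = - a"
    and second: "\<And>i. i \<in> {1..n} \<Longrightarrow> expectation (\<lambda>\<omega>. (X i \<omega>)\<^sup>2) = s"
    and a: "0 \<le> a"
begin

abbreviation W :: "nat \<Rightarrow> 'w \<Rightarrow> real" where
  "W k \<omega> \<equiv> lindley (\<lambda>i. X i \<omega>) k"

lemma X_meas: "i \<in> {1..n} \<Longrightarrow> X i \<in> borel_measurable M"
  using indep by (auto simp: indep_vars_def)

lemma X_int: "i \<in> {1..n} \<Longrightarrow> integrable M (X i)"
  using square_integrable_imp_integrable X_meas sq by blast

lemma W_meas: "k \<le> n \<Longrightarrow> W k \<in> borel_measurable M"
  using X_meas by (intro measurable_lindley) auto

text \<open>\<open>W k\<close> is a function of the first \<open>k\<close> increments alone, an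
  index set disjoint from \<open>{Suc k}\<close>.\<close>

lemma indep_step:
  fixes f g :: "real \<Rightarrow> real"
  assumes k: "Suc k \<le> n" and [measurable]: "f \<in> borel_measurable borel" "g \<in> borel_measurable borel"
  shows "indep_var borel (\<lambda>\<omega>. f (W k \<omega>)) borel (\<lambda>\<omega>. g (X (Suc k) \<omega>))"
proof -
  have "indep_var borel ((\<lambda>x. f (lindley x k)) \<circ> (\<lambda>\<omega>. restrict (\<lambda>i. X i \<omega>) {1..k}))
      borel ((\<lambda>x. g (x (Suc k))) \<circ> (\<lambda>\<omega>. restrict (\<lambda>i. X i \<omega>) {Suc k}))"
  proof (rule indep_var_compose[OF indep_var_restrict[OF indep]])
    have [measurable]: "(\<lambda>x. lindley x k) \<in> borel_measurable (PiM {1..k} (\<lambda>_. borel))"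
      by (intro measurable_lindley) auto
    show "(\<lambda>x. f (lindley x k)) \<in> borel_measurable (PiM {1..k} (\<lambda>_. borel))" by measurable
    show "(\<lambda>x. g (x (Suc k))) \<in> borel_measurable (PiM {Suc k} (\<lambda>_. borel))" by measurable
  qed (use k in auto)
  moreover have "lindley (restrict (\<lambda>i. X i \<omega>) {1..k}) k = W k \<omega>" for \<omega>
    by (rule lindley_cong) auto
  ultimately show ?thesis by (simp add: comp_def)
qed

lemma W_sq: "k \<le> n \<Longrightarrow> integrable M (\<lambda>\<omega>. (W k \<omega>)\<^sup>2)"
proof (induction k)
  case (Suc k)
  show ?case
  proof (rule Bochner_Integration.integrable_bound)
    show "integrable M (\<lambda>\<omega>. 2 * (W k \<omega>)\<^sup>2 + 2 * (X (Suc k) \<omega>)\<^sup>2)" using Suc sq by auto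
    show "(\<lambda>\<omega>. (W (Suc k) \<omega>)\<^sup>2) \<in> borel_measurable M" using W_meas[OF Suc.prems] by measurable
    have "(max 0 (w + x))\<^sup>2 \<le> 2 * w\<^sup>2 + 2 * x\<^sup>2" for w x :: real
      using sum_squares_bound[of w x] by (auto simp: max_def power2_sum)
    then show "AE \<omega> in M. norm ((W (Suc k) \<omega>)\<^sup>2) \<le> norm (2 * (W k \<omega>)\<^sup>2 + 2 * (X (Suc k) \<omega>)\<^sup>2)"
      by (intro AE_I2) auto
  qed
qed simp

lemma W_int: "k \<le> n \<Longrightarrow> integrable M (W k)"
  using square_integrable_imp_integrable W_meas W_sq by blast

lemma product_step:
  fixes f g :: "real \<Rightarrow> real"
  assumes k: "Suc k \<le> n" and "f \<in> borel_measurable borel" "g \<in> borel_measurable borel"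
    and "integrable M (\<lambda>\<omega>. f (W k \<omega>))" "integrable M (\<lambda>\<omega>. g (X (Suc k) \<omega>))"
  shows "integrable M (\<lambda>\<omega>. f (W k \<omega>) * g (X (Suc k) \<omega>))"
    and "expectation (\<lambda>\<omega>. f (W k \<omega>) * g (X (Suc k) \<omega>)) =
      expectation (\<lambda>\<omega>. f (W k \<omega>)) * expectation (\<lambda>\<omega>. g (X (Suc k) \<omega>))"
  using indep_var_integrable[OF indep_step[OF assms(1-3)] assms(4,5)]
    indep_var_lebesgue_integral[OF indep_step[OF assms(1-3)] assms(4,5)] by simp_all

text \<open>Omitting the reset can only enlarge the square. In the expanded square the cross term
  factorises by independence and carries the negative drift.\<close>

lemma second_moment_step:
  assumes k: "Suc k \<le> n"
  shows "expectation (\<lambda>\<omega>. (W (Suc k) \<omega>)\<^sup>2) \<le> expectation (\<lambda>\<omega>. (W k \<omega>)\<^sup>2) - 2 * a * expectation (W k) + s"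
proof -
  have k': "k \<le> n" "Suc k \<in> {1..n}" using k by auto
  have "(\<lambda>x. x) \<in> borel_measurable borel" by measurable
  note p = product_step[OF k this this W_int[OF k'(1)] X_int[OF k'(2)]]
  have "expectation (\<lambda>\<omega>. (W (Suc k) \<omega>)\<^sup>2)
      \<le> expectation (\<lambda>\<omega>. (W k \<omega>)\<^sup>2 + 2 * (W k \<omega> * X (Suc k) \<omega>) + (X (Suc k) \<omega>)\<^sup>2)"
  proof (rule integral_mono)
    show "integrable M (\<lambda>\<omega>. (W k \<omega>)\<^sup>2 + 2 * (W k \<omega> * X (Suc k) \<omega>) + (X (Suc k) \<omega>)\<^sup>2)"
      using p W_sq[OF k'(1)] sq[OF k'(2)] by simp
    have "(max 0 (w + x))\<^sup>2 \<le> w\<^sup>2 + 2 * (w * x) + x\<^sup>2" for w x :: real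
    proof -
      have "(max 0 (w + x))\<^sup>2 \<le> (w + x)\<^sup>2" by (auto simp: max_def)
      then show ?thesis by (simp add: power2_sum)
    qed
    then show "(W (Suc k) \<omega>)\<^sup>2 \<le> (W k \<omega>)\<^sup>2 + 2 * (W k \<omega> * X (Suc k) \<omega>) + (X (Suc k) \<omega>)\<^sup>2" for \<omega> by simp
  qed (rule W_sq[OF k])
  also have "\<dots> = expectation (\<lambda>\<omega>. (W k \<omega>)\<^sup>2) - 2 * a * expectation (W k) + s"
    using p W_sq[OF k'(1)] sq[OF k'(2)] mean[OF k'(2)] second[OF k'(2)] by simp
  finally show ?thesis .
qed

lemma expectation_W_nonneg: "0 \<le> expectation (W k)"
  by (intro Bochner_Integration.integral_nonneg lindley_nonneg)

text \<open>Here the drift term is just discarded, so the bound does not deteriorate as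
  \<open>a\<close> tends to 0.\<close>

lemma second_moment_linear_bound: "expectation (\<lambda>\<omega>. (W n \<omega>)\<^sup>2) \<le> real n * s"
proof -
  have "expectation (\<lambda>\<omega>. (W k \<omega>)\<^sup>2) \<le> real k * s" if "k \<le> n" for k
    using that
  proof (induction k)
    case (Suc k)
    have "0 \<le> 2 * a * expectation (W k)" using a expectation_W_nonneg by auto
    then show ?case using second_moment_step[of k] Suc by (simp add: algebra_simps)
  qed simp
  then show ?thesis by simp
qed

text \<open>The Lyapunov function is \<open>(max 0 (w - 2 * J))\<^sup>2 + s / (2 * a * J) * w\<^sup>2\<close>: the second summand
  loses \<open>s / J * expectation (W k)\<close> per step, which pays for the steps of the first one that start
  above \<open>J\<close>; the other ones need a jump above \<open>J\<close>.\<close>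

lemma second_moment_truncation_bound:
  assumes J: "0 < J" and apos: "0 < a"
    and tail: "\<And>i. i \<in> {1..n} \<Longrightarrow> expectation (\<lambda>\<omega>. (X i \<omega>)\<^sup>2 * indicat_real {J<..} (X i \<omega>)) = e"
  shows "expectation (\<lambda>\<omega>. (W n \<omega>)\<^sup>2) \<le> 8 * J\<^sup>2 + 2 * real n * (s\<^sup>2 / (2 * a * J) + e)"
proof -
  \<comment> \<open>The part of \<open>w\<close> above \<open>2 * J\<close>. The part below
    contributes a bounded amount to the second moment.\<close>
  define v where "v w = max 0 (w - 2 * J)" for w
  have v_meas [measurable]: "v \<in> borel_measurable borel" unfolding v_def by measurable
  have v_nonneg: "0 \<le> v w" for w by (simp add: v_def)
  have v_sq: "integrable M (\<lambda>\<omega>. (v (W k \<omega>))\<^sup>2)" if "k \<le> n" for k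
  proof (rule Bochner_Integration.integrable_bound[OF W_sq[OF that]])
    show "(\<lambda>\<omega>. (v (W k \<omega>))\<^sup>2) \<in> borel_measurable M" using W_meas[OF that] by measurable
    show "AE \<omega> in M. norm ((v (W k \<omega>))\<^sup>2) \<le> norm ((W k \<omega>)\<^sup>2)"
    proof (intro AE_I2)
      fix \<omega>
      have "v (W k \<omega>) \<le> W k \<omega>" using J lindley_nonneg by (simp add: v_def)
      then show "norm ((v (W k \<omega>))\<^sup>2) \<le> norm ((W k \<omega>)\<^sup>2)" using v_nonneg by (simp add: power_mono)
    qed
  qed
  have v_int: "integrable M (\<lambda>\<omega>. v (W k \<omega>))" if "k \<le> n" for k
    using W_int[OF that] unfolding v_def by (intro integrable_max) auto
  \<comment> \<open>This is \<open>truncated_step\<close> in expectation: independence turns the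
    cross term into \<open>- 2 * a\<close> times a nonnegative number, which is dropped, and splits
    the expectation of \<open>W k\<close> times the squared increment.\<close>
  have v_step: "expectation (\<lambda>\<omega>. (v (W (Suc k) \<omega>))\<^sup>2)
      \<le> expectation (\<lambda>\<omega>. (v (W k \<omega>))\<^sup>2) + s * expectation (W k) / J + e" if k: "Suc k \<le> n" for k
  proof -
    have k': "k \<le> n" "Suc k \<in> {1..n}" using k by auto
    have m: "(\<lambda>x. x) \<in> borel_measurable borel" "(\<lambda>x::real. x\<^sup>2) \<in> borel_measurable borel" by measurable
    note p = product_step[OF k v_meas m(1) v_int[OF k'(1)] X_int[OF k'(2)]]
    note q = product_step[OF k m W_int[OF k'(1)] sq[OF k'(2)]]
    have t: "integrable M (\<lambda>\<omega>. (X (Suc k) \<omega>)\<^sup>2 * indicat_real {J<..} (X (Suc k) \<omega>))"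
    proof (rule Bochner_Integration.integrable_bound[OF sq[OF k'(2)]])
      show "(\<lambda>\<omega>. (X (Suc k) \<omega>)\<^sup>2 * indicat_real {J<..} (X (Suc k) \<omega>)) \<in> borel_measurable M"
        using X_meas[OF k'(2)] by measurable
    qed (auto simp: indicator_def)
    have "expectation (\<lambda>\<omega>. (v (W (Suc k) \<omega>))\<^sup>2)
      \<le> expectation (\<lambda>\<omega>. (v (W k \<omega>))\<^sup>2 + 2 * (v (W k \<omega>) * X (Suc k) \<omega>)
          + W k \<omega> * (X (Suc k) \<omega>)\<^sup>2 / J + (X (Suc k) \<omega>)\<^sup>2 * indicat_real {J<..} (X (Suc k) \<omega>))"
    proof (rule integral_mono)
      show "integrable M (\<lambda>\<omega>. (v (W k \<omega>))\<^sup>2 + 2 * (v (W k \<omega>) * X (Suc k) \<omega>)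
          + W k \<omega> * (X (Suc k) \<omega>)\<^sup>2 / J + (X (Suc k) \<omega>)\<^sup>2 * indicat_real {J<..} (X (Suc k) \<omega>))"
        using p q v_sq[OF k'(1)] t by simp
      show "(v (W (Suc k) \<omega>))\<^sup>2 \<le> (v (W k \<omega>))\<^sup>2 + 2 * (v (W k \<omega>) * X (Suc k) \<omega>)
          + W k \<omega> * (X (Suc k) \<omega>)\<^sup>2 / J + (X (Suc k) \<omega>)\<^sup>2 * indicat_real {J<..} (X (Suc k) \<omega>)" for \<omega>
        using truncated_step[OF lindley_nonneg J, of "\<lambda>i. X i \<omega>" k "X (Suc k) \<omega>"]
        unfolding v_def by (simp add: mult.commute)
    qed (rule v_sq[OF k])
    also have "\<dots> = expectation (\<lambda>\<omega>. (v (W k \<omega>))\<^sup>2) - 2 * a * expectation (\<lambda>\<omega>. v (W k \<omega>))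
        + s * expectation (W k) / J + e"
      using p q v_sq[OF k'(1)] t mean[OF k'(2)] second[OF k'(2)] tail[OF k'(2)] by simp
    also have "\<dots> \<le> expectation (\<lambda>\<omega>. (v (W k \<omega>))\<^sup>2) + s * expectation (W k) / J + e"
    proof -
      have "0 \<le> a * expectation (\<lambda>\<omega>. v (W k \<omega>))" using a v_nonneg by (intro mult_nonneg_nonneg Bochner_Integration.integral_nonneg) auto
      then show ?thesis by simp
    qed
    finally show ?thesis .
  qed
  \<comment> \<open>\<open>s\<close> is known to be a second moment only if there is an increment at
    all.\<close>
  have s: "0 \<le> s" if "0 < n" using second[of 1] that
    by (metis Bochner_Integration.integral_nonneg One_nat_def Suc_leI atLeastAtMost_iff le_refl zero_le_power2)
  define c where "c = s / (2 * a * J)"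
  have "expectation (\<lambda>\<omega>. (v (W k \<omega>))\<^sup>2) + c * expectation (\<lambda>\<omega>. (W k \<omega>)\<^sup>2) \<le> real k * (c * s + e)"
    if "k \<le> n" for k
    using that
  proof (induction k)
    case 0
    then show ?case using J by (simp add: v_def)
  next
    case (Suc k)
    have "0 \<le> c" using s Suc.prems a J by (simp add: c_def)
    then have "c * expectation (\<lambda>\<omega>. (W (Suc k) \<omega>)\<^sup>2)
        \<le> c * (expectation (\<lambda>\<omega>. (W k \<omega>)\<^sup>2) - 2 * a * expectation (W k) + s)"
      using second_moment_step[OF Suc.prems] by (intro mult_left_mono) auto
    moreover have "c * (2 * a * expectation (W k)) = s * expectation (W k) / J"
      using apos J by (simp add: c_def field_simps)
    ultimately show ?case using v_step[OF Suc.prems] Suc by (simp add: algebra_simps)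
  qed
  from this[of n] have "expectation (\<lambda>\<omega>. (v (W n \<omega>))\<^sup>2) + c * expectation (\<lambda>\<omega>. (W n \<omega>)\<^sup>2) \<le> real n * (c * s + e)"
    by simp
  moreover have "0 \<le> c * expectation (\<lambda>\<omega>. (W n \<omega>)\<^sup>2)"
    using s a J by (cases "n = 0") (auto simp: c_def intro!: mult_nonneg_nonneg divide_nonneg_nonneg)
  ultimately have v: "expectation (\<lambda>\<omega>. (v (W n \<omega>))\<^sup>2) \<le> real n * (s\<^sup>2 / (2 * a * J) + e)"
    by (simp add: c_def power2_eq_square)
  have "expectation (\<lambda>\<omega>. (W n \<omega>)\<^sup>2) \<le> expectation (\<lambda>\<omega>. 8 * J\<^sup>2 + 2 * (v (W n \<omega>))\<^sup>2)"
  proof (rule integral_mono[OF W_sq])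
    show "integrable M (\<lambda>\<omega>. 8 * J\<^sup>2 + 2 * (v (W n \<omega>))\<^sup>2)" using v_sq by simp
    have "w\<^sup>2 \<le> 8 * J\<^sup>2 + 2 * (v w)\<^sup>2" if "0 \<le> w" for w
    proof (cases "w \<le> 2 * J")
      case True
      then have "w\<^sup>2 \<le> (2 * J)\<^sup>2" using that by (intro power_mono)
      then have "w\<^sup>2 \<le> 4 * J\<^sup>2" by (simp add: power_mult_distrib)
      then show ?thesis using zero_le_power2[of J] zero_le_power2[of "v w"] by linarith
    next
      case False
      \<comment> \<open>This square is exactly the right side minus the left side.\<close>
      have "0 \<le> (w - 4 * J)\<^sup>2" by simp
      then show ?thesis using False by (simp add: v_def power2_eq_square algebra_simps)
    qed
    then show "(W n \<omega>)\<^sup>2 \<le> 8 * J\<^sup>2 + 2 * (v (W n \<omega>))\<^sup>2" for \<omega> using lindley_nonneg by blast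
  qed simp
  also have "\<dots> = 8 * J\<^sup>2 + 2 * expectation (\<lambda>\<omega>. (v (W n \<omega>))\<^sup>2)"
    using v_sq by (simp add: prob_space)
  finally show ?thesis using v by simp
qed

end

text \<open>Serves the time reversal: independence of the steps survives a change of their
  order.\<close>

lemma (in prob_space) indep_vars_reindex_inj:
  assumes X: "indep_vars M' X J" and f: "inj_on f I" "f ` I \<subseteq> J"
  shows "indep_vars (\<lambda>i. M' (f i)) (\<lambda>i. X (f i)) I"
proof -
  let ?F = "\<lambda>i. {X i -` A \<inter> space M | A. A \<in> sets (M' i)}"
  have rv: "\<And>i. i \<in> J \<Longrightarrow> random_variable (M' i) (X i)" and F: "indep_sets ?F J"
    using X by (auto simp: indep_vars_def2)
  have "indep_sets (\<lambda>i. ?F (f i)) I"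
  proof (rule indep_setsI)
    show "?F (f i) \<subseteq> events" if "i \<in> I" for i
      using that f rv[of "f i"] by (auto intro: measurable_sets)
    fix A K assume K: "K \<noteq> {}" "K \<subseteq> I" "finite K" and A: "\<forall>j\<in>K. A j \<in> ?F (f j)"
    have inj: "inj_on f K" using f(1) K(2) by (rule inj_on_subset)
    \<comment> \<open>Moves the events from the indices in \<open>K\<close> to their images, where
      independence is available; injectivity keeps the factors of the product distinct.\<close>
    let ?g = "the_inv_into K f"
    have g: "?g (f j) = j" if "j \<in> K" for j using the_inv_into_f_f[OF inj that] .
    have "prob (\<Inter>j\<in>f ` K. A (?g j)) = (\<Prod>j\<in>f ` K. prob (A (?g j)))"
      by (rule indep_setsD[OF F]) (use K f A g in auto)
    moreover have "(\<Inter>j\<in>f ` K. A (?g j)) = (\<Inter>j\<in>K. A j)" using g by auto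
    moreover have "(\<Prod>j\<in>f ` K. prob (A (?g j))) = (\<Prod>j\<in>K. prob (A j))"
      using g by (subst prod.reindex[OF inj]) (auto intro: prod.cong)
    ultimately show "prob (\<Inter>j\<in>K. A j) = (\<Prod>j\<in>K. prob (A j))" by simp
  qed
  then show ?thesis using rv f by (auto simp: indep_vars_def2)
qed

section \<open>Integration over the open half circle\<close>

lemma has_integral_inner_direction:
  "((\<lambda>\<theta>. x \<bullet> direction u \<theta>) has_integral 2 * (x \<bullet> u)) {-pi/2..pi/2}"
proof -
  let ?B = "x $ 2 * u $ 1 - x $ 1 * u $ 2"
  let ?F = "\<lambda>\<theta>. (x \<bullet> u) * sin \<theta> - ?B * cos \<theta>"
  have "(?F has_vector_derivative x \<bullet> direction u \<theta>) (at \<theta> within S)" for \<theta> S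
    unfolding inner_direction has_real_derivative_iff_has_vector_derivative[symmetric]
    by (auto intro!: derivative_eq_intros)
  then have "((\<lambda>\<theta>. x \<bullet> direction u \<theta>) has_integral ?F (pi/2) - ?F (-pi/2)) {-pi/2..pi/2}"
    by (intro fundamental_theorem_of_calculus) auto
  then show ?thesis by simp
qed

text \<open>The half circle is open so that the drift in direction \<open>\<theta>\<close>, a positive multiple of
  \<open>cos \<theta>\<close>, is positive throughout.\<close>

definition half_circle :: "real measure" where
  "half_circle = restrict_space lborel {-pi/2<..<pi/2}"

lemma space_half_circle: "space half_circle = {-pi/2<..<pi/2}"
  by (simp add: half_circle_def space_restrict_space)

lemma measurable_half_circle: "f \<in> measurable borel N \<Longrightarrow> f \<in> measurable half_circle N"
  unfolding half_circle_def by (rule measurable_restrict_space1) simp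

lemma half_circle_integral:
  fixes f :: "real \<Rightarrow> real"
  assumes "continuous_on {-pi/2..pi/2} f" "(f has_integral c) {-pi/2..pi/2}"
  shows "integrable half_circle f" "integral\<^sup>L half_circle f = c"
proof -
  have s: "set_integrable lborel {-pi/2<..<pi/2} f"
    using borel_integrable_atLeastAtMost'[OF assms(1)] by (rule set_integrable_subset) auto
  then show "integrable half_circle f"
    by (simp add: half_circle_def integrable_restrict_space set_integrable_def)
  have "(f has_integral c) {-pi/2<..<pi/2}" using assms(2) has_integral_Icc_iff_Ioo by blast
  then show "integral\<^sup>L half_circle f = c"
    using set_borel_integral_eq_integral(2)[OF s]
    by (simp add: half_circle_def integral_restrict_space set_lebesgue_integral_def integral_unique)
qed

lemma emeasure_half_circle: "emeasure half_circle (space half_circle) = pi"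
  by (simp add: half_circle_def emeasure_restrict_space)

lemma finite_measure_half_circle: "finite_measure half_circle"
  by standard (simp add: emeasure_half_circle)

text \<open>Cauchy-Schwarz against the constant 1, whose integral is \<open>pi\<close>. In
  \<open>ennreal\<close> the right side may be infinite, so square integrability of \<open>f\<close>
  need not be known beforehand.\<close>

lemma square_half_circle_integral_le:
  fixes f :: "real \<Rightarrow> real"
  assumes int: "integrable half_circle f" and nn: "\<And>\<theta>. 0 \<le> f \<theta>"
  shows "ennreal ((integral\<^sup>L half_circle f)\<^sup>2) \<le> ennreal pi * (\<integral>\<^sup>+\<theta>. ennreal ((f \<theta>)\<^sup>2) \<partial>half_circle)"
proof -
  have [measurable]: "f \<in> borel_measurable half_circle" using int by auto
  have "ennreal ((integral\<^sup>L half_circle f)\<^sup>2) = (\<integral>\<^sup>+\<theta>. ennreal (f \<theta>) * 1 \<partial>half_circle)\<^sup>2"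
    using nn int by (simp add: nn_integral_eq_integral ennreal_power integral_nonneg)
  also have "\<dots> \<le> (\<integral>\<^sup>+\<theta>. (ennreal (f \<theta>))\<^sup>2 \<partial>half_circle) * (\<integral>\<^sup>+\<theta>. 1\<^sup>2 \<partial>half_circle)"
    by (rule Cauchy_Schwarz_nn_integral) measurable
  also have "(\<integral>\<^sup>+\<theta>. 1\<^sup>2 \<partial>half_circle) = ennreal pi"
    by (simp only: power_one nn_integral_const mult_1_left emeasure_half_circle)
  finally show ?thesis using nn by (simp add: ennreal_power mult.commute)
qed

section \<open>Planar random walks with drift\<close>

locale drift_walk = prob_space M for M :: "'w measure" +
  fixes Z :: "nat \<Rightarrow> 'w \<Rightarrow> real^2"
  assumes meas: "\<And>i. i \<ge> 1 \<Longrightarrow> Z i \<in> borel_measurable M"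
    and indep: "indep_vars (\<lambda>_. borel) Z {1..}"
    and ident: "\<And>i. i \<ge> 1 \<Longrightarrow> distr M borel (Z i) = distr M borel (Z 1)"
    and sq_int: "integrable M (\<lambda>\<omega>. (norm (Z 1 \<omega>))\<^sup>2)"
    and mean_nz: "norm (expectation (Z 1)) \<noteq> 0"
begin

section \<open>Moments and tails of a single step\<close>

definition \<mu> :: "real^2" where "\<mu> = expectation (Z 1)"
definition u :: "real^2" where "u = \<mu> /\<^sub>R norm \<mu>"
definition \<sigma>2 :: real where "\<sigma>2 = expectation (\<lambda>\<omega>. (norm (Z 1 \<omega>))\<^sup>2)"
definition tail :: "real \<Rightarrow> real" where
  "tail J = expectation (\<lambda>\<omega>. (norm (Z 1 \<omega>))\<^sup>2 * indicat_real {J<..} (norm (Z 1 \<omega>)))"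

lemma mu_pos: "0 < norm \<mu>"
  using mean_nz by (simp add: \<mu>_def)

lemma norm_u: "norm u = 1"
  using mu_pos by (simp add: u_def)

lemma mu_inner_direction: "\<mu> \<bullet> direction u \<theta> = norm \<mu> * cos \<theta>"
proof -
  have "\<mu> \<bullet> u = norm \<mu>" "\<mu> $ 2 * u $ 1 - \<mu> $ 1 * u $ 2 = 0"
    using mu_pos by (simp_all add: u_def power2_norm_eq_inner[symmetric] power2_eq_square)
  then show ?thesis by (simp add: inner_direction)
qed

lemma Z1_meas [measurable]: "Z 1 \<in> borel_measurable M" "Z (Suc 0) \<in> borel_measurable M"
  by (auto intro: meas)

lemma integrable_Z_iff:
  fixes h :: "real^2 \<Rightarrow> real"
  assumes [measurable]: "h \<in> borel_measurable borel" and i: "1 \<le> i"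
  shows "integrable M (\<lambda>\<omega>. h (Z i \<omega>)) \<longleftrightarrow> integrable M (\<lambda>\<omega>. h (Z 1 \<omega>))"
    and "expectation (\<lambda>\<omega>. h (Z i \<omega>)) = expectation (\<lambda>\<omega>. h (Z 1 \<omega>))"
proof -
  note [measurable] = meas[OF i]
  show "integrable M (\<lambda>\<omega>. h (Z i \<omega>)) \<longleftrightarrow> integrable M (\<lambda>\<omega>. h (Z 1 \<omega>))"
    using ident[OF i] by (subst (1 2) integrable_distr_eq[symmetric, where N=borel]) auto
  show "expectation (\<lambda>\<omega>. h (Z i \<omega>)) = expectation (\<lambda>\<omega>. h (Z 1 \<omega>))"
    using ident[OF i] by (subst (1 2) integral_distr[symmetric, where N=borel]) auto
qed

lemma integrable_Z1: "integrable M (Z 1)"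
proof -
  have "integrable M (\<lambda>\<omega>. norm (Z 1 \<omega>))"
    by (rule square_integrable_imp_integrable[OF _ sq_int]) measurable
  then show ?thesis by (simp add: integrable_norm_iff)
qed

lemma inner_sq_le: "norm w = 1 \<Longrightarrow> (x \<bullet> w)\<^sup>2 \<le> (norm x)\<^sup>2" for x w :: "real^2"
  using Cauchy_Schwarz_ineq2[of x w] by (simp add: abs_le_square_iff[symmetric])

lemma integrable_Z1_inner_sq:
  assumes "norm w = 1"
  shows "integrable M (\<lambda>\<omega>. (Z 1 \<omega> \<bullet> w)\<^sup>2)"
  by (rule Bochner_Integration.integrable_bound[OF sq_int])
    (use inner_sq_le[OF assms] in auto)

lemma Z1_inner_sq_le:
  assumes "norm w = 1"
  shows "expectation (\<lambda>\<omega>. (Z 1 \<omega> \<bullet> w)\<^sup>2) \<le> \<sigma>2"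
  unfolding \<sigma>2_def
  by (rule integral_mono[OF integrable_Z1_inner_sq[OF assms] sq_int]) (rule inner_sq_le[OF assms])

lemma \<sigma>2_nonneg: "0 \<le> \<sigma>2"
  by (simp add: \<sigma>2_def)

lemma integrable_tail: "integrable M (\<lambda>\<omega>. (norm (Z 1 \<omega>))\<^sup>2 * indicat_real {J<..} (norm (Z 1 \<omega>)))"
  by (rule Bochner_Integration.integrable_bound[OF sq_int]) (auto simp: indicator_def)

lemma tail_nonneg: "0 \<le> tail J"
  unfolding tail_def by (intro Bochner_Integration.integral_nonneg) auto

text \<open>A projection onto a unit vector exceeds \<open>J\<close> only where the norm does, which
  makes the tail bound uniform in the direction.\<close>

lemma Z1_inner_tail_le:
  assumes "norm w = 1"
  shows "expectation (\<lambda>\<omega>. (- (Z 1 \<omega> \<bullet> w))\<^sup>2 * indicat_real {J<..} (- (Z 1 \<omega> \<bullet> w))) \<le> tail J"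
  unfolding tail_def
proof (rule integral_mono[OF _ integrable_tail])
  show "integrable M (\<lambda>\<omega>. (- (Z 1 \<omega> \<bullet> w))\<^sup>2 * indicat_real {J<..} (- (Z 1 \<omega> \<bullet> w)))"
    by (rule Bochner_Integration.integrable_bound[OF integrable_Z1_inner_sq[OF assms]])
       (auto simp: indicator_def)
  show "(- (Z 1 \<omega> \<bullet> w))\<^sup>2 * indicat_real {J<..} (- (Z 1 \<omega> \<bullet> w))
      \<le> (norm (Z 1 \<omega>))\<^sup>2 * indicat_real {J<..} (norm (Z 1 \<omega>))" for \<omega>
    using inner_sq_le[OF assms, of "Z 1 \<omega>"] Cauchy_Schwarz_ineq2[of "Z 1 \<omega>" w] assms
    by (auto simp: indicator_def)
qed

lemma tail_tendsto: "(tail \<longlongrightarrow> 0) at_top"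
proof -
  have "((\<lambda>J. expectation (\<lambda>\<omega>. (norm (Z 1 \<omega>))\<^sup>2 * indicat_real {J<..} (norm (Z 1 \<omega>))))
      \<longlongrightarrow> expectation (\<lambda>\<omega>. 0)) at_top"
  proof (rule integral_dominated_convergence_at_top[OF _ _ sq_int])
    show "AE \<omega> in M. ((\<lambda>J. (norm (Z 1 \<omega>))\<^sup>2 * indicat_real {J<..} (norm (Z 1 \<omega>))) \<longlongrightarrow> 0) at_top"
    proof (intro AE_I2 tendsto_eventually)
      fix \<omega>
      show "\<forall>\<^sub>F J in at_top. (norm (Z 1 \<omega>))\<^sup>2 * indicat_real {J<..} (norm (Z 1 \<omega>)) = 0"
        using eventually_ge_at_top[of "norm (Z 1 \<omega>)"] by eventually_elim auto
    qed
    show "\<forall>\<^sub>F J in at_top. AE \<omega> in M. norm ((norm (Z 1 \<omega>))\<^sup>2 * indicat_real {J<..} (norm (Z 1 \<omega>))) \<le> (norm (Z 1 \<omega>))\<^sup>2"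
      by (auto simp: indicator_def)
  qed auto
  then show ?thesis by (simp add: tail_def[abs_def])
qed

text \<open>The index map \<open>p\<close> covers the identity and the time reversal at once. The
  sign turns the forward drift \<open>\<mu> \<bullet> w\<close> into a negative mean.\<close>

lemma lindley_walk_inner:
  assumes w: "norm w = 1" "0 \<le> \<mu> \<bullet> w" and p: "inj_on p {1..n}" "\<And>i. i \<in> {1..n} \<Longrightarrow> 1 \<le> p i"
  shows "lindley_walk M (\<lambda>i \<omega>. - (Z (p i) \<omega> \<bullet> w)) n (\<mu> \<bullet> w) (expectation (\<lambda>\<omega>. (Z 1 \<omega> \<bullet> w)\<^sup>2))"
proof
  have "indep_vars (\<lambda>_. borel) (\<lambda>i. Z (p i)) {1..n}"
    by (rule indep_vars_reindex_inj[OF indep p(1)]) (use p(2) in auto)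
  then show "indep_vars (\<lambda>_. borel) (\<lambda>i \<omega>. - (Z (p i) \<omega> \<bullet> w)) {1..n}"
    by (rule indep_vars_compose2[where Y="\<lambda>_ z. - (z \<bullet> w)"]) auto
  fix i assume i: "i \<in> {1..n}"
  have sq: "(\<lambda>z. (z \<bullet> w)\<^sup>2) \<in> borel_measurable borel" and id: "(\<lambda>z. z \<bullet> w) \<in> borel_measurable borel"
    by measurable
  show "integrable M (\<lambda>\<omega>. (- (Z (p i) \<omega> \<bullet> w))\<^sup>2)"
    using integrable_Z_iff(1)[OF sq p(2)[OF i]] integrable_Z1_inner_sq[OF w(1)] by simp
  show "expectation (\<lambda>\<omega>. (- (Z (p i) \<omega> \<bullet> w))\<^sup>2) = expectation (\<lambda>\<omega>. (Z 1 \<omega> \<bullet> w)\<^sup>2)"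
    using integrable_Z_iff(2)[OF sq p(2)[OF i]] by simp
  show "expectation (\<lambda>\<omega>. - (Z (p i) \<omega> \<bullet> w)) = - (\<mu> \<bullet> w)"
    using integrable_Z_iff(2)[OF id p(2)[OF i]] integrable_Z1 by (simp add: \<mu>_def)
qed (rule w)

text \<open>Any truncation level that tends to infinity more slowly than \<open>sqrt n\<close> would do in place of
  \<open>n powr (1/4)\<close>.\<close>

definition rate :: "nat \<Rightarrow> real \<Rightarrow> real" where
  "rate n \<theta> = min \<sigma>2 (8 * (real n powr (1/4))\<^sup>2 / real n
     + \<sigma>2\<^sup>2 / (norm \<mu> * cos \<theta> * real n powr (1/4)) + 2 * tail (real n powr (1/4)))"

text \<open>The two arguments of \<open>min\<close> in \<open>rate\<close> come from
  \<open>second_moment_linear_bound\<close> and from \<open>second_moment_truncation_bound\<close>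
  at level \<open>n powr (1/4)\<close>, with all moments of the projection replaced by those of the
  norm.\<close>

lemma lindley_second_moment_le:
  assumes \<theta>: "\<theta> \<in> {-pi/2<..<pi/2}" and p: "inj_on p {1..n}" "\<And>i. i \<in> {1..n} \<Longrightarrow> 1 \<le> p i"
  defines "W \<equiv> (\<lambda>\<omega>. lindley (\<lambda>i. - (Z (p i) \<omega> \<bullet> direction u \<theta>)) n)"
  shows "integrable M (\<lambda>\<omega>. (W \<omega>)\<^sup>2)" and "expectation (\<lambda>\<omega>. (W \<omega>)\<^sup>2) \<le> real n * rate n \<theta>"
proof -
  let ?w = "direction u \<theta>"
  have w: "norm ?w = 1" using norm_direction[OF norm_u] .
  have "0 < cos \<theta>" using \<theta> by (intro cos_gt_zero_pi) auto
  then have drift: "0 < \<mu> \<bullet> ?w" using mu_pos by (simp add: mu_inner_direction)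
  interpret lindley_walk M "\<lambda>i \<omega>. - (Z (p i) \<omega> \<bullet> ?w)" n "\<mu> \<bullet> ?w" "expectation (\<lambda>\<omega>. (Z 1 \<omega> \<bullet> ?w)\<^sup>2)"
    using lindley_walk_inner[OF w less_imp_le[OF drift] p] .
  show "integrable M (\<lambda>\<omega>. (W \<omega>)\<^sup>2)" unfolding W_def by (rule W_sq) simp
  let ?s = "expectation (\<lambda>\<omega>. (Z 1 \<omega> \<bullet> ?w)\<^sup>2)"
  have s: "0 \<le> ?s" "?s \<le> \<sigma>2" using Z1_inner_sq_le[OF w] by auto
  have 1: "expectation (\<lambda>\<omega>. (W \<omega>)\<^sup>2) \<le> real n * \<sigma>2"
    unfolding W_def by (rule order_trans[OF second_moment_linear_bound mult_left_mono[OF s(2)]]) simp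
  show "expectation (\<lambda>\<omega>. (W \<omega>)\<^sup>2) \<le> real n * rate n \<theta>"
  proof (cases "n = 0")
    case False
    define J where "J = real n powr (1/4)"
    have J: "0 < J" using False by (simp add: J_def)
    let ?h = "\<lambda>z. (- (z \<bullet> ?w))\<^sup>2 * indicat_real {J<..} (- (z \<bullet> ?w))"
    have h: "?h \<in> borel_measurable borel" by measurable
    have "expectation (\<lambda>\<omega>. (W \<omega>)\<^sup>2) \<le> 8 * J\<^sup>2 + 2 * real n *
        (?s\<^sup>2 / (2 * (\<mu> \<bullet> ?w) * J) + expectation (\<lambda>\<omega>. ?h (Z 1 \<omega>)))"
      unfolding W_def using integrable_Z_iff(2)[OF h p(2)]
      by (intro second_moment_truncation_bound[OF J drift]) auto
    also have "\<dots> \<le> 8 * J\<^sup>2 + 2 * real n * (\<sigma>2\<^sup>2 / (2 * (\<mu> \<bullet> ?w) * J) + tail J)"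
      using Z1_inner_tail_le[OF w, of J] s drift J
      by (intro add_mono mult_left_mono divide_right_mono power_mono) auto
    also have "\<dots> = real n * (8 * J\<^sup>2 / real n + \<sigma>2\<^sup>2 / (norm \<mu> * cos \<theta> * J) + 2 * tail J)"
      using False by (simp add: mu_inner_direction algebra_simps)
    finally show ?thesis using 1 unfolding rate_def J_def[symmetric] by (auto simp: min_def)
  qed (use 1 in simp)
qed

section \<open>Excess of the width of the hull over the projected end point\<close>

definition G :: "nat \<Rightarrow> real \<Rightarrow> 'w \<Rightarrow> real" where
  "G n \<theta> \<omega> = lindley (\<lambda>i. - (Z i \<omega> \<bullet> direction u \<theta>)) n
    + lindley (\<lambda>i. - (Z (Suc n - i) \<omega> \<bullet> direction u \<theta>)) n"

lemma G_nonneg: "0 \<le> G n \<theta> \<omega>"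
  by (simp add: G_def lindley_nonneg)

text \<open>The two Lindley values share their steps and are dependent, so the square of the sum is
  bounded by twice the sum of the squares; this gives the factor 4.\<close>

lemma G_second_moment:
  assumes \<theta>: "\<theta> \<in> {-pi/2<..<pi/2}"
  shows "integrable M (\<lambda>\<omega>. (G n \<theta> \<omega>)\<^sup>2)" "expectation (\<lambda>\<omega>. (G n \<theta> \<omega>)\<^sup>2) \<le> 4 * real n * rate n \<theta>"
proof -
  let ?A = "\<lambda>\<omega>. lindley (\<lambda>i. - (Z i \<omega> \<bullet> direction u \<theta>)) n"
  let ?B = "\<lambda>\<omega>. lindley (\<lambda>i. - (Z (Suc n - i) \<omega> \<bullet> direction u \<theta>)) n"
  note A = lindley_second_moment_le[OF \<theta>, of "\<lambda>i. i" n]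
  have "inj_on (\<lambda>i. Suc n - i) {1..n}" by (auto simp: inj_on_def)
  note B = lindley_second_moment_le[OF \<theta> this]
  have "1 \<le> Suc n - i" if "i \<in> {1..n}" for i using that by auto
  note B = B[OF this]
  have A: "integrable M (\<lambda>\<omega>. (?A \<omega>)\<^sup>2)" "expectation (\<lambda>\<omega>. (?A \<omega>)\<^sup>2) \<le> real n * rate n \<theta>"
    using A by auto
  have B: "integrable M (\<lambda>\<omega>. (?B \<omega>)\<^sup>2)" "expectation (\<lambda>\<omega>. (?B \<omega>)\<^sup>2) \<le> real n * rate n \<theta>"
    using B by simp_all
  have m: "?A \<in> borel_measurable M" "?B \<in> borel_measurable M"
    by (auto intro!: measurable_lindley borel_measurable_uminus borel_measurable_inner meas)
  have le: "(G n \<theta> \<omega>)\<^sup>2 \<le> 2 * (?A \<omega>)\<^sup>2 + 2 * (?B \<omega>)\<^sup>2" for \<omega>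
    using sum_squares_bound[of "?A \<omega>" "?B \<omega>"] by (simp add: G_def power2_sum)
  show int: "integrable M (\<lambda>\<omega>. (G n \<theta> \<omega>)\<^sup>2)"
  proof (rule Bochner_Integration.integrable_bound)
    show "integrable M (\<lambda>\<omega>. 2 * (?A \<omega>)\<^sup>2 + 2 * (?B \<omega>)\<^sup>2)" using A B by simp
    show "(\<lambda>\<omega>. (G n \<theta> \<omega>)\<^sup>2) \<in> borel_measurable M" using m unfolding G_def by measurable
  qed (use le in \<open>auto intro!: order_trans[OF le]\<close>)
  have "expectation (\<lambda>\<omega>. (G n \<theta> \<omega>)\<^sup>2) \<le> expectation (\<lambda>\<omega>. 2 * (?A \<omega>)\<^sup>2 + 2 * (?B \<omega>)\<^sup>2)"
    using A B le by (intro integral_mono int) auto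
  also have "\<dots> = 2 * expectation (\<lambda>\<omega>. (?A \<omega>)\<^sup>2) + 2 * expectation (\<lambda>\<omega>. (?B \<omega>)\<^sup>2)" using A B by simp
  finally show "expectation (\<lambda>\<omega>. (G n \<theta> \<omega>)\<^sup>2) \<le> 4 * real n * rate n \<theta>" using A B by simp
qed

lemma walk_inner: "walk Z n \<omega> \<bullet> w = (\<Sum>i = 1..n. Z i \<omega> \<bullet> w)"
  by (simp add: walk_def inner_sum_left)

text \<open>\<open>lindley_last_exit\<close> supplies the maximum minus the final value,
  \<open>lindley_reversed\<close> the negated minimum.\<close>

lemma G_eq_width:
  "G n \<theta> \<omega> = Max ((\<lambda>p. p \<bullet> direction u \<theta>) ` (\<lambda>k. walk Z k \<omega>) ` {0..n})
     - Min ((\<lambda>p. p \<bullet> direction u \<theta>) ` (\<lambda>k. walk Z k \<omega>) ` {0..n}) - walk Z n \<omega> \<bullet> direction u \<theta>"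
  unfolding G_def image_image walk_inner
    lindley_last_exit[of "\<lambda>i. Z i \<omega> \<bullet> direction u \<theta>" n] lindley_reversed[of "\<lambda>i. Z i \<omega> \<bullet> direction u \<theta>" n]
  by simp

definition Q :: "nat \<Rightarrow> 'w \<Rightarrow> real" where
  "Q n \<omega> = hull_perimeter Z n \<omega> - 2 * (walk Z n \<omega> \<bullet> u)"

text \<open>Cauchy's formula minus the integral of the projected end point; continuity in the angle
  connects the gauge integral with the Lebesgue integral.\<close>

lemma half_circle_integral_G:
  shows "integrable half_circle (\<lambda>\<theta>. G n \<theta> \<omega>)" "integral\<^sup>L half_circle (\<lambda>\<theta>. G n \<theta> \<omega>) = Q n \<omega>"
proof -
  let ?P = "(\<lambda>k. walk Z k \<omega>) ` {0..n}"
  have "((\<lambda>\<theta>. G n \<theta> \<omega>) has_integral Q n \<omega>) {-pi/2..pi/2}"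
    unfolding G_eq_width Q_def hull_perimeter_def
    by (intro has_integral_diff has_integral_width_perimeter has_integral_inner_direction norm_u) auto
  moreover have "continuous_on {-pi/2..pi/2} (\<lambda>\<theta>. G n \<theta> \<omega>)"
    unfolding G_eq_width by (intro continuous_intros continuous_on_Max_image continuous_on_Min_image) auto
  ultimately show "integrable half_circle (\<lambda>\<theta>. G n \<theta> \<omega>)" "integral\<^sup>L half_circle (\<lambda>\<theta>. G n \<theta> \<omega>) = Q n \<omega>"
    using half_circle_integral by blast+
qed

section \<open>Joint measurability and the averaged rate\<close>

lemma measurable_G: "(\<lambda>(\<theta>, \<omega>). G n \<theta> \<omega>) \<in> borel_measurable (half_circle \<Otimes>\<^sub>M M)"
proof -
  have [measurable]: "direction u \<in> borel_measurable half_circle"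
    using borel_measurable_continuous_onI[OF continuous_on_direction] by (rule measurable_half_circle)
  have "(\<lambda>x. - (Z i (snd x) \<bullet> direction u (fst x))) \<in> borel_measurable (half_circle \<Otimes>\<^sub>M M)" if "1 \<le> i" for i
    using meas[OF that] by measurable
  then show ?thesis unfolding G_def split_beta
    by (intro borel_measurable_add measurable_lindley) auto
qed

lemma measurable_G': "(\<lambda>(\<omega>, \<theta>). G n \<theta> \<omega>) \<in> borel_measurable (M \<Otimes>\<^sub>M half_circle)"
  using measurable_compose[OF measurable_pair_swap' measurable_G] by (simp add: split_beta')

lemma rate_measurable [measurable]: "rate n \<in> borel_measurable half_circle"
proof -
  have [measurable]: "(\<lambda>\<theta>. cos \<theta>) \<in> borel_measurable half_circle"
    by (intro measurable_half_circle) measurable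
  show ?thesis unfolding rate_def[abs_def] by measurable
qed

lemma rate_bounds:
  assumes "\<theta> \<in> {-pi/2<..<pi/2}"
  shows "0 \<le> rate n \<theta>" "rate n \<theta> \<le> \<sigma>2"
proof -
  have "0 < cos \<theta>" using assms by (intro cos_gt_zero_pi) auto
  then show "0 \<le> rate n \<theta>" using mu_pos tail_nonneg \<sigma>2_nonneg unfolding rate_def
    by (auto intro!: add_nonneg_nonneg divide_nonneg_nonneg)
qed (simp add: rate_def)

lemma integrable_rate: "integrable half_circle (rate n)"
proof (rule finite_measure.integrable_const_bound[OF finite_measure_half_circle])
  show "AE \<theta> in half_circle. norm (rate n \<theta>) \<le> \<sigma>2"
    using rate_bounds by (intro AE_I2) (auto simp: space_half_circle)
qed measurable

lemma integral_rate_nonneg: "0 \<le> integral\<^sup>L half_circle (rate n)"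
  using rate_bounds by (intro Bochner_Integration.integral_nonneg) (auto simp: space_half_circle)

text \<open>With \<open>J = n powr (1/4)\<close>, both \<open>J\<^sup>2 / n\<close> and
  \<open>1 / J\<close> tend to 0, and the tail vanishes as \<open>J\<close> grows. Convergence is
  pointwise only: the middle term blows up as \<open>cos \<theta>\<close> approaches 0.\<close>

lemma rate_tendsto:
  assumes "\<theta> \<in> {-pi/2<..<pi/2}"
  shows "(\<lambda>n. rate n \<theta>) \<longlonglongrightarrow> 0"
proof -
  have J: "filterlim (\<lambda>n. real n powr (1/4)) at_top sequentially" by real_asymp
  have 1: "(\<lambda>n. 8 * (real n powr (1/4))\<^sup>2 / real n) \<longlonglongrightarrow> 0" by real_asymp
  have c: "0 < norm \<mu> * cos \<theta>" using assms mu_pos by (auto intro!: mult_pos_pos cos_gt_zero_pi)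
  have 2: "(\<lambda>n. \<sigma>2\<^sup>2 / (norm \<mu> * cos \<theta> * real n powr (1/4))) \<longlonglongrightarrow> 0"
    by (intro tendsto_divide_0[OF tendsto_const] filterlim_at_top_imp_at_infinity
        filterlim_tendsto_pos_mult_at_top[OF tendsto_const c J])
  have 3: "(\<lambda>n. 2 * tail (real n powr (1/4))) \<longlonglongrightarrow> 2 * 0"
    by (intro tendsto_intros filterlim_compose[OF tail_tendsto J])
  have "(\<lambda>n. rate n \<theta>) \<longlonglongrightarrow> min \<sigma>2 (0 + 0 + 2 * 0)"
    unfolding rate_def by (intro tendsto_intros 1 2 3)
  then show ?thesis using \<sigma>2_nonneg by simp
qed

text \<open>The \<open>min\<close> in \<open>rate\<close> provides the constant majorant
  \<open>\<sigma>2\<close>, integrable over the half circle, which takes care of directions almost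
  orthogonal to the drift.\<close>

lemma integral_rate_tendsto: "(\<lambda>n. integral\<^sup>L half_circle (rate n)) \<longlonglongrightarrow> 0"
proof -
  have "(\<lambda>n. integral\<^sup>L half_circle (rate n)) \<longlonglongrightarrow> integral\<^sup>L half_circle (\<lambda>_. 0)"
  proof (rule integral_dominated_convergence)
    show "integrable half_circle (\<lambda>_. \<sigma>2)"
      using finite_measure.integrable_const[OF finite_measure_half_circle] .
    show "AE \<theta> in half_circle. (\<lambda>n. rate n \<theta>) \<longlonglongrightarrow> 0"
      using rate_tendsto by (intro AE_I2) (auto simp: space_half_circle)
    show "AE \<theta> in half_circle. norm (rate n \<theta>) \<le> \<sigma>2" for n
      using rate_bounds by (intro AE_I2) (auto simp: space_half_circle)
  qed measurable
  then show ?thesis by simp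
qed

section \<open>Variance of the remainder\<close>

lemma Q_meas [measurable]: "Q n \<in> borel_measurable M"
proof -
  interpret H: finite_measure half_circle by (rule finite_measure_half_circle)
  have "(\<lambda>\<omega>. integral\<^sup>L half_circle (\<lambda>\<theta>. G n \<theta> \<omega>)) \<in> borel_measurable M"
    using measurable_G' by (intro H.borel_measurable_lebesgue_integral) auto
  then show ?thesis by (simp add: half_circle_integral_G(2)[abs_def])
qed

text \<open>Cauchy-Schwarz in the angle, Tonelli, then the bound for each direction. Everything runs
  in \<open>ennreal\<close>, so that integrability comes out as a consequence of the finite
  bound.\<close>

lemma Q_second_moment:
  shows "integrable M (\<lambda>\<omega>. (Q n \<omega>)\<^sup>2)"
    and "expectation (\<lambda>\<omega>. (Q n \<omega>)\<^sup>2) \<le> 4 * pi * real n * integral\<^sup>L half_circle (rate n)"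
proof -
  interpret H: finite_measure half_circle by (rule finite_measure_half_circle)
  interpret pair_sigma_finite half_circle M ..
  let ?c = "4 * pi * real n * integral\<^sup>L half_circle (rate n)"
  have sq: "(\<lambda>(\<theta>, \<omega>). ennreal ((G n \<theta> \<omega>)\<^sup>2)) \<in> borel_measurable (half_circle \<Otimes>\<^sub>M M)"
    using measurable_G[of n] by (simp add: split_beta')
  note nn = integral_rate_nonneg[of n]
  have "(\<integral>\<^sup>+\<omega>. ennreal ((Q n \<omega>)\<^sup>2) \<partial>M) \<le> (\<integral>\<^sup>+\<omega>. ennreal pi * (\<integral>\<^sup>+\<theta>. ennreal ((G n \<theta> \<omega>)\<^sup>2) \<partial>half_circle) \<partial>M)"
    using square_half_circle_integral_le[OF half_circle_integral_G(1) G_nonneg]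
    by (intro nn_integral_mono) (simp add: half_circle_integral_G(2))
  also have "\<dots> = ennreal pi * (\<integral>\<^sup>+\<omega>. (\<integral>\<^sup>+\<theta>. ennreal ((G n \<theta> \<omega>)\<^sup>2) \<partial>half_circle) \<partial>M)"
    using sq measurable_G'[of n] by (intro nn_integral_cmult H.borel_measurable_nn_integral) (simp add: split_beta')
  also have "(\<integral>\<^sup>+\<omega>. (\<integral>\<^sup>+\<theta>. ennreal ((G n \<theta> \<omega>)\<^sup>2) \<partial>half_circle) \<partial>M)
      = (\<integral>\<^sup>+\<theta>. (\<integral>\<^sup>+\<omega>. ennreal ((G n \<theta> \<omega>)\<^sup>2) \<partial>M) \<partial>half_circle)"
    by (rule Fubini'[OF sq])
  also have "\<dots> \<le> (\<integral>\<^sup>+\<theta>. ennreal (4 * real n * rate n \<theta>) \<partial>half_circle)"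
  proof (intro nn_integral_mono)
    fix \<theta> assume "\<theta> \<in> space half_circle"
    then have \<theta>: "\<theta> \<in> {-pi/2<..<pi/2}" by (simp add: space_half_circle)
    show "(\<integral>\<^sup>+\<omega>. ennreal ((G n \<theta> \<omega>)\<^sup>2) \<partial>M) \<le> ennreal (4 * real n * rate n \<theta>)"
      using G_second_moment[OF \<theta>] by (subst nn_integral_eq_integral) (auto intro: ennreal_leI)
  qed
  also have "\<dots> = ennreal (4 * real n * integral\<^sup>L half_circle (rate n))"
    using rate_bounds integrable_rate
    by (subst nn_integral_eq_integral) (auto simp: space_half_circle intro!: AE_I2)
  finally have "(\<integral>\<^sup>+\<omega>. ennreal ((Q n \<omega>)\<^sup>2) \<partial>M)
      \<le> ennreal pi * ennreal (4 * real n * integral\<^sup>L half_circle (rate n))"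
    by (simp add: mult_left_mono mult_right_mono)
  also have "\<dots> = ennreal ?c" using nn by (simp add: ennreal_mult[symmetric] algebra_simps)
  finally have le: "(\<integral>\<^sup>+\<omega>. ennreal ((Q n \<omega>)\<^sup>2) \<partial>M) \<le> ennreal ?c" .
  have fin: "(\<integral>\<^sup>+\<omega>. ennreal ((Q n \<omega>)\<^sup>2) \<partial>M) < \<infinity>"
    using le by (simp add: order.strict_trans1)
  then show int: "integrable M (\<lambda>\<omega>. (Q n \<omega>)\<^sup>2)"
    by (intro integrableI_bounded) auto
  show "expectation (\<lambda>\<omega>. (Q n \<omega>)\<^sup>2) \<le> ?c"
    using le nn by (subst (asm) nn_integral_eq_integral[OF int]) (auto simp: ennreal_le_iff)
qed

lemma Q_integrable: "integrable M (Q n)"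
  by (rule square_integrable_imp_integrable[OF Q_meas Q_second_moment(1)])

lemma integrable_walk: "integrable M (\<lambda>\<omega>. walk Z n \<omega> \<bullet> u)" "expectation (\<lambda>\<omega>. walk Z n \<omega> \<bullet> u) = real n * (\<mu> \<bullet> u)"
proof -
  have h: "(\<lambda>z. z \<bullet> u) \<in> borel_measurable borel" by measurable
  have i: "integrable M (\<lambda>\<omega>. Z i \<omega> \<bullet> u)" "expectation (\<lambda>\<omega>. Z i \<omega> \<bullet> u) = \<mu> \<bullet> u" if "i \<in> {1..n}" for i
    using integrable_Z_iff[OF h, of i] that integrable_Z1 by (simp_all add: \<mu>_def)
  show "integrable M (\<lambda>\<omega>. walk Z n \<omega> \<bullet> u)" unfolding walk_inner using i by (intro Bochner_Integration.integrable_sum) auto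
  show "expectation (\<lambda>\<omega>. walk Z n \<omega> \<bullet> u) = real n * (\<mu> \<bullet> u)"
    unfolding walk_inner using i by (subst Bochner_Integration.integral_sum) auto
qed

text \<open>Since \<open>u\<close> is \<open>\<mu>\<close> normalised, the subtracted sum is
  \<open>2 * (walk Z n \<omega> \<bullet> u)\<close> minus its expectation.\<close>

lemma hull_perimeter_deviation:
  "hull_perimeter Z n \<omega> - expectation (hull_perimeter Z n) - (\<Sum>i = 1..n. 2 * ((Z i \<omega> - \<mu>) \<bullet> \<mu>) / norm \<mu>)
    = Q n \<omega> - expectation (Q n)"
proof -
  have "hull_perimeter Z n = (\<lambda>\<omega>. Q n \<omega> + 2 * (walk Z n \<omega> \<bullet> u))" by (simp add: Q_def fun_eq_iff)
  then have "expectation (hull_perimeter Z n) = expectation (Q n) + 2 * (real n * (\<mu> \<bullet> u))"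
    using Q_integrable integrable_walk by simp
  moreover have "(\<Sum>i = 1..n. 2 * ((Z i \<omega> - \<mu>) \<bullet> \<mu>) / norm \<mu>) = (\<Sum>i = 1..n. 2 * (Z i \<omega> \<bullet> u) - 2 * (\<mu> \<bullet> u))"
    by (intro sum.cong) (auto simp: u_def inner_diff_left right_diff_distrib divide_inverse algebra_simps)
  moreover have "\<dots> = 2 * (walk Z n \<omega> \<bullet> u) - 2 * (real n * (\<mu> \<bullet> u))"
    by (simp add: sum_subtractf walk_inner sum_distrib_left)
  ultimately show ?thesis by (simp add: Q_def)
qed

text \<open>The expectation of \<open>Y n\<close> is the variance of \<open>Q n\<close> divided by
  \<open>n\<close>, and the variance is at most the second moment; the factor \<open>n\<close> in
  \<open>Q_second_moment\<close> cancels.\<close>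

lemma deviation_L2:
  defines "Y \<equiv> (\<lambda>n \<omega>. (real n powr (-1/2) * \<bar>Q n \<omega> - expectation (Q n)\<bar>)\<^sup>2)"
  shows "integrable M (Y n)" and "(\<lambda>n. expectation (Y n)) \<longlonglongrightarrow> 0"
proof -
  have Y: "Y n = (\<lambda>\<omega>. (real n powr (-1/2))\<^sup>2 * ((Q n \<omega>)\<^sup>2 - 2 * expectation (Q n) * Q n \<omega> + (expectation (Q n))\<^sup>2))" for n
    by (auto simp: Y_def power_mult_distrib power2_diff fun_eq_iff algebra_simps)
  show "integrable M (Y n)" for n
    unfolding Y using Q_integrable Q_second_moment(1) by simp
  have upper: "expectation (Y n) \<le> 4 * pi * integral\<^sup>L half_circle (rate n)" for n
  proof (cases "n = 0")
    case True
    \<comment> \<open>\<open>0 powr (-1/2)\<close> is 0, so \<open>Y 0\<close> vanishes.\<close>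
    then show ?thesis using integral_rate_nonneg by (simp add: Y)
  next
    case False
    have "expectation (Y n) = (real n powr (-1/2))\<^sup>2 * (expectation (\<lambda>\<omega>. (Q n \<omega>)\<^sup>2) - (expectation (Q n))\<^sup>2)"
      unfolding Y using Q_integrable Q_second_moment(1)
      by (simp add: prob_space power2_eq_square)
    also have "\<dots> \<le> (real n powr (-1/2))\<^sup>2 * (4 * pi * real n * integral\<^sup>L half_circle (rate n))"
      using Q_second_moment(2)[of n] by (intro mult_left_mono) (auto intro: order_trans[rotated])
    also have "(real n powr (-1/2))\<^sup>2 = 1 / real n"
      using False by (simp add: power2_eq_square powr_add[symmetric] powr_minus_divide)
    finally show ?thesis using False by simp
  qed
  have lower: "0 \<le> expectation (Y n)" for n
    by (auto simp: Y_def intro!: Bochner_Integration.integral_nonneg)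
  have "(\<lambda>n. 4 * pi * integral\<^sup>L half_circle (rate n)) \<longlonglongrightarrow> 4 * pi * 0"
    by (intro tendsto_intros integral_rate_tendsto)
  then have lim: "(\<lambda>n. 4 * pi * integral\<^sup>L half_circle (rate n)) \<longlonglongrightarrow> 0" by simp
  show "(\<lambda>n. expectation (Y n)) \<longlonglongrightarrow> 0"
    by (rule tendsto_sandwich[OF always_eventually always_eventually tendsto_const lim])
      (use upper lower in blast)+
qed

end

theorem theorem1p3:
  fixes M :: "'w measure" and Z :: "nat \<Rightarrow> 'w \<Rightarrow> real^2"
  assumes "prob_space M"
    and meas: "\<And>i. i \<ge> 1 \<Longrightarrow> Z i \<in> borel_measurable M"
    and indep: "prob_space.indep_vars M (\<lambda>_. borel) Z {1..}"
    and ident: "\<And>i. i \<ge> 1 \<Longrightarrow> distr M borel (Z i) = distr M borel (Z 1)"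
    and sq_int: "integrable M (\<lambda>\<omega>. (norm (Z 1 \<omega>))\<^sup>2)"
    and mean_nz: "norm (integral\<^sup>L M (Z 1)) \<noteq> 0"
  shows "(\<forall>n. integrable M (\<lambda>\<omega>.
            (real n powr (-1/2) *
              \<bar>hull_perimeter Z n \<omega> - integral\<^sup>L M (hull_perimeter Z n)
               - (\<Sum>i = 1..n. 2 * ((Z i \<omega> - integral\<^sup>L M (Z 1)) \<bullet> integral\<^sup>L M (Z 1))
                                / norm (integral\<^sup>L M (Z 1)))\<bar>)\<^sup>2))
       \<and> (\<lambda>n. integral\<^sup>L M (\<lambda>\<omega>.
            (real n powr (-1/2) *
              \<bar>hull_perimeter Z n \<omega> - integral\<^sup>L M (hull_perimeter Z n)
               - (\<Sum>i = 1..n. 2 * ((Z i \<omega> - integral\<^sup>L M (Z 1)) \<bullet> integral\<^sup>L M (Z 1))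
                                / norm (integral\<^sup>L M (Z 1)))\<bar>)\<^sup>2)) \<longlonglongrightarrow> 0"
proof -
  interpret prob_space M by fact
  interpret drift_walk M Z
    by standard (fact meas indep ident sq_int mean_nz)+
  show ?thesis
    unfolding hull_perimeter_deviation[unfolded \<mu>_def] by (intro conjI allI deviation_L2)
qed

end
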